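(* Let $\Delta$ be one of $\Delta_n$ ($n\ge1$), $\Delta_{\mathbb{N}}$, $\Delta_{\mathbb{Z}}$, with corresponding index set $I=\{0,\ldots,n\}$, $\mathbb{N}$, $\mathbb{Z}$. Let $G$ be a Lie group with Lie algebra $\mathfrak{g}$. If $G$ is exponential (the exponential map $\mathfrak{g}\to G$ is onto), then the map $$\Omega^1(\Delta,\mathfrak{g})\to PC_I(G),\qquad \theta\mapsto \text{the holonomy matrix of }\theta,$$ is onto.
   Context: $PC_I(G)$ is the set of families $(a_{i,j})_{(i,j)\in I^2}$ in $G$ with $a_{j,i}=a_{i,j}^{-1}$ and $a_{i,i}=1_G$. Simplices: $\Delta_n=\{(x_0,\ldots,x_n)\in\mathbb{R}^{n+1}: \sum x_i=1,\ x_i\ge0\}$, and for $I=\mathbb{N}$ or $\mathbb{Z}$, $\Delta_I=\{(x_i)_{i\in I}\in l^1(I,\mathbb{R}): x_i\ge 0,\ \sum_i x_i=1\}$. The vertices $s_i$ ($i\in I$) are the standard basis vectors, and $[s_i,s_j]$ is the oriented affine edge from $s_i$ to $s_j$. $c*c'$ denotes concatenation ($c$ first), $c^{-1}$ the reversed path. $G$ is a Lie group, possibly infinite-dimensional (even a Frölicher Lie group with Lie algebra), in which the logarithmic equations defining holonomy are solvable for smooth paths in $\mathfrak{g}$ (automatic in finite dimension). $\Omega^1(\Delta,\mathfrak{g})$ is the space of smooth $\mathfrak{g}$-valued 1-forms on $\Delta$ (in the Frölicher/diffeological sense in the infinite-dimensional cases), identified with the connections on the trivial principal bundle $\Delta\times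 G$. Holonomy: for $\theta\in\Omega^1(\Delta,\mathfrak{g})$ and a piecewise smooth path $c:[0,1]\to\Delta$, $Hol(c)=u(1)$, where $u:[0,1]\to G$ is the horizontal lift with $u(0)=1_G$, i.e. $u'u^{-1}=-\theta(c')$. Thus $Hol(c*c')=Hol(c')\,Hol(c)$. Let $\gamma_0$ be the constant path at $s_0$, $\gamma_i=[s_0,s_1]*\cdots*[s_{i-1},s_i]$ for $i>0$, $\gamma_i=[s_0,s_{-1}]*\cdots*[s_{i+1},s_i]$ for $i<0$, and $g_i=Hol(\gamma_i)$. The holonomy matrix of $\theta$ is $A=(a_{i,j})$ with $$a_{i,j}=g_j\cdot Hol\left(\gamma_i*[s_i,s_j]*\gamma_j^{-1}\right)\cdot g_i^{-1},$$ that is, $a_{i,j}=Hol([s_i,s_j])$. *)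

theory Defs
  imports "HOL-Analysis.Analysis" "HOL-Algebra.Group"
begin

section \<open>The Banach space of absolutely summable families\<close>

typedef 'i l1 = "{x :: 'i \<Rightarrow> real. (\<lambda>i. \<bar>x i\<bar>) summable_on UNIV}"
  morphisms coord Abs_l1
  by (rule exI[of _ "\<lambda>_. 0"]) simp

lemma coord_summable: "(\<lambda>i. \<bar>coord x i\<bar>) summable_on UNIV"
  using coord by auto

lemma l1_eqI: "(\<And>i. coord x i = coord y i) \<Longrightarrow> x = y"
  by (metis coord_inject ext)

instantiation l1 :: (type) real_normed_vector
begin

definition zero_l1 :: "'a l1" where "0 = Abs_l1 (\<lambda>_. 0)"
definition plus_l1 :: "'a l1 \<Rightarrow> 'a l1 \<Rightarrow> 'a l1"
  where "x + y = Abs_l1 (\<lambda>i. coord x i + coord y i)"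
definition minus_l1 :: "'a l1 \<Rightarrow> 'a l1 \<Rightarrow> 'a l1"
  where "x - y = Abs_l1 (\<lambda>i. coord x i - coord y i)"
definition uminus_l1 :: "'a l1 \<Rightarrow> 'a l1"
  where "- x = Abs_l1 (\<lambda>i. - coord x i)"
definition scaleR_l1 :: "real \<Rightarrow> 'a l1 \<Rightarrow> 'a l1"
  where "r *\<^sub>R x = Abs_l1 (\<lambda>i. r * coord x i)"
definition norm_l1 :: "'a l1 \<Rightarrow> real"
  where "norm x = (\<Sum>\<^sub>\<infinity>i. \<bar>coord x i\<bar>)"
definition sgn_l1 :: "'a l1 \<Rightarrow> 'a l1"
  where "sgn (x :: 'a l1) = inverse (norm x) *\<^sub>R x"
definition dist_l1 :: "'a l1 \<Rightarrow> 'a l1 \<Rightarrow> real"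
  where "dist (x :: 'a l1) y = norm (x - y)"
definition uniformity_l1 :: "('a l1 \<times> 'a l1) filter"
  where "uniformity_l1 = (INF e\<in>{0<..}. principal {(x, y). dist x y < e})"
definition open_l1 :: "'a l1 set \<Rightarrow> bool"
  where "open_l1 U = (\<forall>x\<in>U. eventually (\<lambda>(x', y). x' = x \<longrightarrow> y \<in> U) uniformity)"

lemma coord_add_aux: "coord (x + y) = (\<lambda>i. coord x i + coord y i)"
proof -
  have "(\<lambda>i. \<bar>coord x i + coord y i\<bar>) summable_on UNIV"
    by (rule summable_on_comparison_test[OF summable_on_add[OF coord_summable[of x] coord_summable[of y]]])
      (simp_all add: abs_triangle_ineq)
  then show ?thesis by (simp add: plus_l1_def Abs_l1_inverse)
qed

lemma coord_scaleR_aux: "coord (r *\<^sub>R x) = (\<lambda>i. r * coord x i)"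
proof -
  have "(\<lambda>i. \<bar>r * coord x i\<bar>) summable_on UNIV"
    using summable_on_cmult_right[OF coord_summable[of x], of "\<bar>r\<bar>"] by (simp add: abs_mult)
  then show ?thesis by (simp add: scaleR_l1_def Abs_l1_inverse)
qed

lemma coord_uminus_aux: "coord (- x) = (\<lambda>i. - coord x i)"
  using coord_summable[of x] by (simp add: uminus_l1_def Abs_l1_inverse)

lemma coord_zero_aux: "coord 0 = (\<lambda>_. 0)"
  by (simp add: zero_l1_def Abs_l1_inverse)

lemma minus_l1_aux: "x - y = x + - (y :: 'a l1)"
  by (simp add: minus_l1_def plus_l1_def coord_uminus_aux)

instance
proof
  fix x y z :: "'a l1" and a b :: real
  show "x + y + z = x + (y + z)" "x + y = y + x" "0 + x = x" "- x + x = 0"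
       "x - y = x + - y"
       "a *\<^sub>R (x + y) = a *\<^sub>R x + a *\<^sub>R y" "(a + b) *\<^sub>R x = a *\<^sub>R x + b *\<^sub>R x"
       "a *\<^sub>R b *\<^sub>R x = (a * b) *\<^sub>R x" "1 *\<^sub>R x = x"
    by (auto intro!: l1_eqI simp: minus_l1_aux coord_add_aux coord_zero_aux coord_uminus_aux
          coord_scaleR_aux algebra_simps)
  show "dist x y = norm (x - y)" by (rule dist_l1_def)
  show "sgn x = inverse (norm x) *\<^sub>R x" by (rule sgn_l1_def)
  show "uniformity = (INF e\<in>{0<..}. principal {(x :: 'a l1, y). dist x y < e})"
    by (rule uniformity_l1_def)
  show "open U = (\<forall>x\<in>U. \<forall>\<^sub>F (x', y) in uniformity. x' = x \<longrightarrow> y \<in> U)" for U :: "'a l1 set"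
    by (rule open_l1_def)
  note s = coord_summable
  show "norm x = 0 \<longleftrightarrow> x = 0"
  proof
    assume "norm x = 0"
    then have "\<bar>coord x i\<bar> = 0" for i
      using nonneg_infsum_le_0D[OF _ s[of x], of i] by (simp add: norm_l1_def)
    then show "x = 0" by (intro l1_eqI) (simp add: coord_zero_aux)
  qed (simp add: norm_l1_def coord_zero_aux)
  have "norm (x + y) \<le> (\<Sum>\<^sub>\<infinity>i. \<bar>coord x i\<bar> + \<bar>coord y i\<bar>)"
    unfolding norm_l1_def
    by (rule infsum_mono[OF s summable_on_add[OF s s]])
      (simp add: coord_add_aux abs_triangle_ineq)
  then show "norm (x + y) \<le> norm x + norm y"
    by (simp add: norm_l1_def infsum_add[OF s s])
  show "norm (a *\<^sub>R x) = \<bar>a\<bar> * norm x"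
    by (simp add: norm_l1_def coord_scaleR_aux abs_mult infsum_cmult_right')
qed

end

section \<open>Simplices\<close>

text \<open>
  All index sets are subsets of \<open>int\<close>: \<open>{0..n}\<close>, \<open>{0..}\<close> and \<open>UNIV\<close>. The families in
  \<open>int l1\<close> supported on \<open>I\<close> form a copy of \<open>l1(I)\<close>; for \<open>I = {0..n}\<close> this is the
  space of real \<open>(n+1)\<close>-tuples with its usual topology and smooth structure.
\<close>

definition std_simplex :: "int set \<Rightarrow> int l1 set" where
  "std_simplex I = {x. (\<forall>i. 0 \<le> coord x i) \<and> (\<forall>i. i \<notin> I \<longrightarrow> coord x i = 0)
                  \<and> (\<Sum>\<^sub>\<infinity>i. coord x i) = 1}"

text \<open>Direction space of the affine hull of the simplex; the tangent bundle is
  \<open>std_simplex I \<times> simplex_tangent I\<close>.\<close>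

definition simplex_tangent :: "int set \<Rightarrow> int l1 set" where
  "simplex_tangent I = {v. (\<forall>i. i \<notin> I \<longrightarrow> coord v i = 0) \<and> (\<Sum>\<^sub>\<infinity>i. coord v i) = 0}"

definition vertex :: "int \<Rightarrow> int l1" where
  "vertex i = Abs_l1 (\<lambda>j. if j = i then 1 else 0)"

section \<open>Smooth curves\<close>

text \<open>\<open>C\<^sup>\<infinity>\<close> on \<open>S\<close>, with one-sided derivatives at the end points when \<open>S\<close> is a closed
  interval; \<open>D n\<close> is the \<open>n\<close>-th derivative.\<close>

definition smooth_curve_on :: "real set \<Rightarrow> (real \<Rightarrow> 'v::real_normed_vector) \<Rightarrow> bool" where
  "smooth_curve_on S c \<longleftrightarrow>
     (\<exists>D :: nat \<Rightarrow> real \<Rightarrow> 'v. D 0 = c \<and>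
        (\<forall>n. \<forall>t\<in>S. (D n has_vector_derivative D (Suc n) t) (at t within S)))"

section \<open>Froelicher Lie groups\<close>

record 'g frolicher_monoid = "'g monoid" +
  curves :: "(real \<Rightarrow> 'g) set"
  funs :: "('g \<Rightarrow> real) set"

text \<open>The curves and the functions of a Froelicher structure determine each other. Functions
  are total on the type \<open>'g\<close>; their values off the carrier play no role. The second part says
  that multiplication and inversion are smooth, i.e. map smooth curves (of the product
  structure, in the case of multiplication) to smooth curves.\<close>

definition frolicher_group :: "('g, 'm) frolicher_monoid_scheme \<Rightarrow> bool" where
  "frolicher_group G \<longleftrightarrow> group G \<and>
     curves G = {c. range c \<subseteq> carrier G \<and> (\<forall>f\<in>funs G. smooth_curve_on UNIV (\<lambda>t. f (c t)))} \<and>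
     funs G = {f. \<forall>c\<in>curves G. smooth_curve_on UNIV (\<lambda>t. f (c t))} \<and>
     (\<forall>c\<in>curves G. \<forall>d\<in>curves G. (\<lambda>t. c t \<otimes>\<^bsub>G\<^esub> d t) \<in> curves G) \<and>
     (\<forall>c\<in>curves G. (\<lambda>t. inv\<^bsub>G\<^esub> (c t)) \<in> curves G)"

text \<open>A tangent vector at the unit is a class of smooth curves through the unit, where two curves
  are identified if every smooth function has the same derivative along both. The class of \<open>c\<close> is
  represented by the functional \<open>f \<mapsto> (f \<circ> c)'(0)\<close>, set to \<open>0\<close> on non-smooth \<open>f\<close> so that
  it is determined by its values on \<open>funs G\<close>. Vector operations are pointwise.\<close>

type_synonym 'g tvec = "('g \<Rightarrow> real) \<Rightarrow> real"

definition velocity :: "('g, 'm) frolicher_monoid_scheme \<Rightarrow> (real \<Rightarrow> 'g) \<Rightarrow> 'g tvec" where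
  "velocity G c = (\<lambda>f. if f \<in> funs G then deriv (\<lambda>t. f (c t)) 0 else 0)"

definition lie_alg :: "('g, 'm) frolicher_monoid_scheme \<Rightarrow> 'g tvec set" where
  "lie_alg G = {velocity G c | c. c \<in> curves G \<and> c 0 = \<one>\<^bsub>G\<^esub>}"

definition Ad :: "('g, 'm) frolicher_monoid_scheme \<Rightarrow> 'g \<Rightarrow> 'g tvec \<Rightarrow> 'g tvec" where
  "Ad G g X = (\<lambda>f. if f \<in> funs G then X (\<lambda>x. f (g \<otimes>\<^bsub>G\<^esub> x \<otimes>\<^bsub>G\<^esub> inv\<^bsub>G\<^esub> g)) else 0)"

text \<open>\<open>Z\<close> is the derivative at the unit, in direction \<open>X\<close>, of \<open>g \<mapsto> Ad g Y\<close>.\<close>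

definition is_ad :: "('g, 'm) frolicher_monoid_scheme \<Rightarrow> 'g tvec \<Rightarrow> 'g tvec \<Rightarrow> 'g tvec \<Rightarrow> bool" where
  "is_ad G X Y Z \<longleftrightarrow>
     (\<forall>c\<in>curves G. c 0 = \<one>\<^bsub>G\<^esub> \<and> velocity G c = X \<longrightarrow>
        (\<forall>f\<in>funs G. ((\<lambda>t. Ad G (c t) Y f) has_real_derivative Z f) (at 0)))"

text \<open>A Froelicher group is a Froelicher Lie group if its tangent space at the unit is a vector
  space on which the derivative of the adjoint action is a Lie bracket. (Finite-dimensional Lie
  groups, with their smooth curves and smooth functions, are instances.)\<close>

definition frolicher_lie_group :: "('g, 'm) frolicher_monoid_scheme \<Rightarrow> bool" where
  "frolicher_lie_group G \<longleftrightarrow> frolicher_group G \<and>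
     (\<forall>X\<in>lie_alg G. \<forall>Y\<in>lie_alg G. \<forall>a b. (\<lambda>f. a * X f + b * Y f) \<in> lie_alg G) \<and>
     (\<exists>B. (\<forall>X\<in>lie_alg G. \<forall>Y\<in>lie_alg G. B X Y \<in> lie_alg G \<and> is_ad G X Y (B X Y)) \<and>
          (\<forall>X\<in>lie_alg G. \<forall>Y\<in>lie_alg G. \<forall>Z\<in>lie_alg G. \<forall>a b.
             B (\<lambda>f. a * X f + b * Y f) Z = (\<lambda>f. a * B X Z f + b * B Y Z f) \<and>
             B Z (\<lambda>f. a * X f + b * Y f) = (\<lambda>f. a * B Z X f + b * B Z Y f)) \<and>
          (\<forall>X\<in>lie_alg G. B X X = (\<lambda>f. 0)) \<and>
          (\<forall>X\<in>lie_alg G. \<forall>Y\<in>lie_alg G. \<forall>Z\<in>lie_alg G.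
             (\<lambda>f. B X (B Y Z) f + B Y (B Z X) f + B Z (B X Y) f) = (\<lambda>f. 0)))"

section \<open>Logarithmic equations and the exponential map\<close>

definition smooth_group_path ::
  "('g, 'm) frolicher_monoid_scheme \<Rightarrow> real set \<Rightarrow> (real \<Rightarrow> 'g) \<Rightarrow> bool" where
  "smooth_group_path G S u \<longleftrightarrow> u ` S \<subseteq> carrier G \<and> (\<forall>f\<in>funs G. smooth_curve_on S (\<lambda>t. f (u t)))"

text \<open>The tangent space at the unit carries the Froelicher structure of the tangent bundle,
  generated by the differentials of the smooth functions, i.e. by the evaluations
  \<open>X \<mapsto> X f\<close> for \<open>f \<in> funs G\<close>.\<close>

definition smooth_alg_path ::
  "('g, 'm) frolicher_monoid_scheme \<Rightarrow> real set \<Rightarrow> (real \<Rightarrow> 'g tvec) \<Rightarrow> bool" where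
  "smooth_alg_path G S v \<longleftrightarrow> v ` S \<subseteq> lie_alg G \<and> (\<forall>f\<in>funs G. smooth_curve_on S (\<lambda>t. v t f))"

text \<open>\<open>u' u\<^sup>-\<^sup>1 = v\<close> on \<open>S\<close>: the velocity of \<open>s \<mapsto> u s (u t)\<^sup>-\<^sup>1\<close> at \<open>s = t\<close> is \<open>v t\<close>.\<close>

definition log_derivative ::
  "('g, 'm) frolicher_monoid_scheme \<Rightarrow> real set \<Rightarrow> (real \<Rightarrow> 'g) \<Rightarrow> (real \<Rightarrow> 'g tvec) \<Rightarrow> bool" where
  "log_derivative G S u v \<longleftrightarrow>
     (\<forall>t\<in>S. \<forall>f\<in>funs G.
        ((\<lambda>s. f (u s \<otimes>\<^bsub>G\<^esub> inv\<^bsub>G\<^esub> (u t))) has_real_derivative v t f) (at t within S))"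

definition solves_log ::
  "('g, 'm) frolicher_monoid_scheme \<Rightarrow> (real \<Rightarrow> 'g tvec) \<Rightarrow> (real \<Rightarrow> 'g) \<Rightarrow> bool" where
  "solves_log G v u \<longleftrightarrow> smooth_group_path G {0..1} u \<and> u 0 = \<one>\<^bsub>G\<^esub> \<and> log_derivative G {0..1} u v"

text \<open>The logarithmic equation of every smooth path in the Lie algebra has exactly one solution
  (uniqueness is automatic when the smooth functions separate points), so that holonomy is
  well-defined.\<close>

definition log_solvable :: "('g, 'm) frolicher_monoid_scheme \<Rightarrow> bool" where
  "log_solvable G \<longleftrightarrow>
     (\<forall>v. smooth_alg_path G {0..1} v \<longrightarrow>
        (\<exists>u. solves_log G v u \<and> (\<forall>w. solves_log G v w \<longrightarrow> (\<forall>t\<in>{0..1}. w t = u t))))"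

definition lie_exp :: "('g, 'm) frolicher_monoid_scheme \<Rightarrow> 'g tvec \<Rightarrow> 'g" where
  "lie_exp G X = (THE g. \<exists>u. solves_log G (\<lambda>_. X) u \<and> g = u 1)"

definition exponential :: "('g, 'm) frolicher_monoid_scheme \<Rightarrow> bool" where
  "exponential G \<longleftrightarrow> lie_exp G ` lie_alg G = carrier G"

section \<open>Connection forms and holonomy\<close>

text \<open>Smooth Lie-algebra-valued one-forms: fibrewise linear, smooth maps from
  \<open>std_simplex I \<times> simplex_tangent I\<close> to the Lie algebra. Smoothness is tested, as for Froelicher
  spaces, along smooth paths; paths on a closed interval are used because the edges of the simplex
  do not extend to curves in the simplex defined on an open interval. For \<open>I = {0..n}\<close> these are
  the usual smooth forms; in infinite dimension they induce diffeological forms by pull-back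
  to plots. Values outside the bundle are
  irrelevant.\<close>

definition one_forms ::
  "('g, 'm) frolicher_monoid_scheme \<Rightarrow> int set \<Rightarrow> (int l1 \<Rightarrow> int l1 \<Rightarrow> 'g tvec) set" where
  "one_forms G I = {\<theta>.
     (\<forall>x\<in>std_simplex I. \<forall>v\<in>simplex_tangent I. \<theta> x v \<in> lie_alg G) \<and>
     (\<forall>x\<in>std_simplex I. \<forall>v\<in>simplex_tangent I. \<forall>w\<in>simplex_tangent I. \<forall>a b.
        \<theta> x (a *\<^sub>R v + b *\<^sub>R w) = (\<lambda>f. a * \<theta> x v f + b * \<theta> x w f)) \<and>
     (\<forall>c w. smooth_curve_on {0..1} c \<and> smooth_curve_on {0..1} w \<and>
        c ` {0..1} \<subseteq> std_simplex I \<and> w ` {0..1} \<subseteq> simplex_tangent I \<longrightarrow>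
        smooth_alg_path G {0..1} (\<lambda>t. \<theta> (c t) (w t)))}"

text \<open>Horizontal lift of a piecewise smooth path \<open>c\<close> on \<open>{0..1}\<close>: \<open>u' u\<^sup>-\<^sup>1 = - \<theta>(c')\<close> on
  every closed interval whose interior avoids the finite set \<open>P\<close> of break points. As these closed
  intervals share their end points, \<open>u\<close> and \<open>c\<close> are continuous.\<close>

definition horizontal_lift ::
  "('g, 'm) frolicher_monoid_scheme \<Rightarrow> (int l1 \<Rightarrow> int l1 \<Rightarrow> 'g tvec) \<Rightarrow> (real \<Rightarrow> int l1)
     \<Rightarrow> (real \<Rightarrow> 'g) \<Rightarrow> bool" where
  "horizontal_lift G \<theta> c u \<longleftrightarrow>
     (\<exists>P. finite P \<and>
        (\<forall>a b. 0 \<le> a \<and> a < b \<and> b \<le> 1 \<and> {a<..<b} \<inter> P = {} \<longrightarrow>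
           smooth_curve_on {a..b} c \<and> smooth_group_path G {a..b} u \<and>
           log_derivative G {a..b} u
             (\<lambda>t f. - \<theta> (c t) (vector_derivative c (at t within {a..b})) f)))"

definition Hol ::
  "('g, 'm) frolicher_monoid_scheme \<Rightarrow> (int l1 \<Rightarrow> int l1 \<Rightarrow> 'g tvec) \<Rightarrow> (real \<Rightarrow> int l1) \<Rightarrow> 'g" where
  "Hol G \<theta> c = (THE g. \<exists>u. horizontal_lift G \<theta> c u \<and> u 0 = \<one>\<^bsub>G\<^esub> \<and> g = u 1)"

text \<open>\<open>[p 0, p 1] * \<dots> * [p (k-1), p k]\<close>, and the constant path at \<open>p 0\<close> for \<open>k = 0\<close>.\<close>

fun broken_line :: "(nat \<Rightarrow> 'v::real_normed_vector) \<Rightarrow> nat \<Rightarrow> real \<Rightarrow> 'v" where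
  "broken_line p 0 = (\<lambda>_. p 0)"
| "broken_line p (Suc 0) = linepath (p 0) (p (Suc 0))"
| "broken_line p (Suc (Suc k)) =
     broken_line p (Suc k) +++ linepath (p (Suc k)) (p (Suc (Suc k)))"

definition vertex_path :: "int \<Rightarrow> real \<Rightarrow> int l1" where
  "vertex_path i = (if 0 \<le> i then broken_line (\<lambda>k. vertex (int k)) (nat i)
              else broken_line (\<lambda>k. vertex (- int k)) (nat (- i)))"

definition holonomy_matrix ::
  "('g, 'm) frolicher_monoid_scheme \<Rightarrow> int set \<Rightarrow> (int l1 \<Rightarrow> int l1 \<Rightarrow> 'g tvec)
     \<Rightarrow> (int \<times> int \<Rightarrow> 'g)" where
  "holonomy_matrix G I \<theta> = (\<lambda>(i, j) \<in> I \<times> I.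
     Hol G \<theta> (vertex_path j)
       \<otimes>\<^bsub>G\<^esub> Hol G \<theta> ((vertex_path i +++ linepath (vertex i) (vertex j)) +++ reversepath (vertex_path j))
       \<otimes>\<^bsub>G\<^esub> inv\<^bsub>G\<^esub> (Hol G \<theta> (vertex_path i)))"

definition PC :: "('g, 'm) monoid_scheme \<Rightarrow> int set \<Rightarrow> (int \<times> int \<Rightarrow> 'g) set" where
  "PC G I = {a \<in> (I \<times> I) \<rightarrow>\<^sub>E carrier G.
     (\<forall>i\<in>I. \<forall>j\<in>I. a (j, i) = inv\<^bsub>G\<^esub> (a (i, j))) \<and> (\<forall>i\<in>I. a (i, i) = \<one>\<^bsub>G\<^esub>)}"

end

theory Submission
  imports Defs
begin

text \<open>
  Holonomy turns concatenation into multiplication and reversal into inversion, so \<open>a\<^sub>i\<^sub>j\<close> is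
  the holonomy of the single edge from \<open>vertex i\<close> to \<open>vertex j\<close>, and the holonomy
  matrix lies in \<open>PC G I\<close>. Conversely, given \<open>a\<close> in \<open>PC G I\<close>, choose for
  \<open>i < j\<close> an \<open>X\<^sub>i\<^sub>j\<close> in the Lie algebra with \<open>exp X\<^sub>i\<^sub>j = a\<^sub>i\<^sub>j\<close> and put
  \<open>\<theta> = - r \<Sum> \<psi>(x\<^sub>i) \<psi>(x\<^sub>j) dx\<^sub>j X\<^sub>i\<^sub>j\<close>, the sum being over \<open>i < j\<close>, where \<open>\<psi>\<close> is
  smooth, nonnegative, and positive exactly beyond \<open>1/4\<close>. At most three coordinates of a point
  of the simplex exceed \<open>1/4\<close>, and along a path, which has compact image, only finitely many ever
  do; hence \<open>\<theta>\<close> is smooth. On the edge from \<open>vertex i\<close> to \<open>vertex j\<close> it equals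
  \<open>- p' X\<^sub>i\<^sub>j dt\<close> with \<open>p' = r \<psi>(1 - t) \<psi>(t)\<close>, whose horizontal lift is \<open>exp (p(t) X\<^sub>i\<^sub>j)\<close>;
  the constant \<open>r\<close> is chosen such that \<open>p\<close> runs from \<open>0\<close> to \<open>1\<close>.
\<close>

section \<open>Calculus of smooth curves\<close>

text \<open>Iterating a choice of derivatives yields the required sequence \<open>D\<close>.
  Smoothness can thus be proved by exhibiting a set of functions closed under taking derivatives,
  without computing higher derivatives.\<close>

lemma smooth_curve_on_coinduct:
  assumes "f \<in> A"
    and step: "\<And>g. g \<in> A \<Longrightarrow> \<exists>g'\<in>A. \<forall>t\<in>S. (g has_vector_derivative g' t) (at t within S)"
  shows "smooth_curve_on S f"
proof -
  obtain d where d: "\<And>g. g \<in> A \<Longrightarrow> d g \<in> A \<and> (\<forall>t\<in>S. (g has_vector_derivative d g t) (at t within S))"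
    using step by metis
  have "(d ^^ n) f \<in> A" for n
    by (induction n) (use assms(1) d in auto)
  then show ?thesis
    unfolding smooth_curve_on_def by (intro exI[of _ "\<lambda>n. (d ^^ n) f"]) (use d in auto)
qed

lemma smooth_curve_onE:
  assumes "smooth_curve_on S f"
  obtains f' where "smooth_curve_on S f'" "\<forall>t\<in>S. (f has_vector_derivative f' t) (at t within S)"
proof -
  from assms obtain D where D: "D 0 = f" "\<And>n t. t \<in> S \<Longrightarrow> (D n has_vector_derivative D (Suc n) t) (at t within S)"
    unfolding smooth_curve_on_def by blast
  have "smooth_curve_on S (D (Suc 0))"
    unfolding smooth_curve_on_def by (rule exI[of _ "\<lambda>n. D (Suc n)"]) (use D in auto)
  with that D show ?thesis by metis
qed

lemma smooth_curve_onI: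
  assumes "smooth_curve_on S f'" "\<forall>t\<in>S. (f has_vector_derivative f' t) (at t within S)"
  shows "smooth_curve_on S f"
proof (rule smooth_curve_on_coinduct)
  show "f \<in> insert f {g. smooth_curve_on S g}" by simp
  fix g assume "g \<in> insert f {g. smooth_curve_on S g}"
  then show "\<exists>g'\<in>insert f {g. smooth_curve_on S g}. \<forall>t\<in>S. (g has_vector_derivative g' t) (at t within S)"
    using assms by (metis insertCI insertE mem_Collect_eq smooth_curve_onE)
qed

lemma smooth_curve_on_cong:
  assumes "smooth_curve_on S f" "\<And>t. t \<in> S \<Longrightarrow> g t = f t"
  shows "smooth_curve_on S g"
proof -
  from assms(1) obtain f' where f': "smooth_curve_on S f'"
    "\<forall>t\<in>S. (f has_vector_derivative f' t) (at t within S)"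
    by (rule smooth_curve_onE)
  have "\<forall>t\<in>S. (g has_vector_derivative f' t) (at t within S)"
    by (intro ballI has_vector_derivative_transform[OF _ assms(2) bspec[OF f'(2)]])
  with f'(1) show ?thesis by (rule smooth_curve_onI)
qed

lemma smooth_curve_on_imp_continuous_on:
  assumes "smooth_curve_on S f"
  shows "continuous_on S f"
  using assms
  by (rule smooth_curve_onE)
    (meson continuous_on_eq_continuous_within has_vector_derivative_continuous)

lemma smooth_curve_on_const [simp]: "smooth_curve_on S (\<lambda>_. x)"
  by (rule smooth_curve_on_coinduct[of _ "range (\<lambda>y _. y)"]) (auto intro!: exI[of _ 0])

lemma smooth_curve_on_affine:
  assumes "smooth_curve_on T f" "\<And>t. t \<in> S \<Longrightarrow> m * t + k \<in> T"
  shows "smooth_curve_on S (\<lambda>t. f (m * t + k))"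
proof (rule smooth_curve_on_coinduct)
  \<comment> \<open>The factor \<open>r\<close> absorbs the powers of \<open>m\<close> that the
    chain rule produces.\<close>
  let ?A = "{\<lambda>t. r *\<^sub>R g (m * t + k) | r g. smooth_curve_on T g}"
  show "(\<lambda>t. f (m * t + k)) \<in> ?A"
    using assms(1) by (auto intro!: exI[of _ "1::real"] exI[of _ f])
  fix h assume "h \<in> ?A"
  then obtain r g where h: "h = (\<lambda>t. r *\<^sub>R g (m * t + k))" and g: "smooth_curve_on T g" by blast
  from g obtain g' where g': "smooth_curve_on T g'"
    "\<forall>t\<in>T. (g has_vector_derivative g' t) (at t within T)"
    by (rule smooth_curve_onE)
  show "\<exists>h'\<in>?A. \<forall>t\<in>S. (h has_vector_derivative h' t) (at t within S)"
  proof (intro bexI ballI)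
    show "(\<lambda>t. (r * m) *\<^sub>R g' (m * t + k)) \<in> ?A" using g' by blast
    fix t assume t: "t \<in> S"
    have "((\<lambda>t. m * t + k) has_vector_derivative m) (at t within S)"
      by (auto intro!: derivative_eq_intros)
    moreover have "(g has_vector_derivative g' (m * t + k)) (at (m * t + k) within (\<lambda>t. m * t + k) ` S)"
      by (rule has_vector_derivative_within_subset[OF bspec[OF g'(2)]]) (use assms(2) t in auto)
    ultimately have "(g \<circ> (\<lambda>t. m * t + k) has_vector_derivative m *\<^sub>R g' (m * t + k)) (at t within S)"
      by (rule vector_diff_chain_within)
    from bounded_linear.has_vector_derivative[OF bounded_linear_scaleR_right this, of r]
    show "(h has_vector_derivative (r * m) *\<^sub>R g' (m * t + k)) (at t within S)"
      by (simp add: h o_def)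
  qed
qed

lemma smooth_curve_on_subset:
  assumes "smooth_curve_on T f" "S \<subseteq> T"
  shows "smooth_curve_on S f"
  using smooth_curve_on_affine[OF assms(1), of S 1 0] assms(2) by auto

lemma smooth_curve_on_bounded_linear:
  assumes "bounded_linear L" "smooth_curve_on S f"
  shows "smooth_curve_on S (\<lambda>t. L (f t))"
proof (rule smooth_curve_on_coinduct)
  let ?A = "{\<lambda>t. L (g t) | g. smooth_curve_on S g}"
  show "(\<lambda>t. L (f t)) \<in> ?A" using assms(2) by blast
  fix h assume "h \<in> ?A"
  then obtain g where h: "h = (\<lambda>t. L (g t))" and g: "smooth_curve_on S g" by blast
  from g obtain g' where "smooth_curve_on S g'"
    "\<forall>t\<in>S. (g has_vector_derivative g' t) (at t within S)"
    by (rule smooth_curve_onE)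
  then show "\<exists>h'\<in>?A. \<forall>t\<in>S. (h has_vector_derivative h' t) (at t within S)"
    by (intro bexI[of _ "\<lambda>t. L (g' t)"])
      (auto simp: h intro: bounded_linear.has_vector_derivative[OF assms(1)])
qed

text \<open>Closing a set of functions under ring operations allows coinduction up to sums and products:
  it is enough that the derivatives of the generators lie in the hull.\<close>

inductive_set ring_hull :: "(real \<Rightarrow> real) set \<Rightarrow> (real \<Rightarrow> real) set" for B where
  base: "f \<in> B \<Longrightarrow> f \<in> ring_hull B"
| const: "(\<lambda>_. r) \<in> ring_hull B"
| add: "f \<in> ring_hull B \<Longrightarrow> g \<in> ring_hull B \<Longrightarrow> (\<lambda>t. f t + g t) \<in> ring_hull B"
| mult: "f \<in> ring_hull B \<Longrightarrow> g \<in> ring_hull B \<Longrightarrow> (\<lambda>t. f t * g t) \<in> ring_hull B"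

lemma smooth_curve_on_ring_hull:
  assumes step: "\<And>g. g \<in> B \<Longrightarrow> \<exists>g'\<in>ring_hull B. \<forall>t\<in>S. (g has_vector_derivative g' t) (at t within S)"
    and "f \<in> ring_hull B"
  shows "smooth_curve_on S f"
  using assms(2)
proof (rule smooth_curve_on_coinduct)
  fix g assume "g \<in> ring_hull B"
  then show "\<exists>g'\<in>ring_hull B. \<forall>t\<in>S. (g has_vector_derivative g' t) (at t within S)"
  proof induction
    case (const r)
    show ?case by (intro bexI[OF _ ring_hull.const[of 0]]) simp
  next
    case (add f g)
    then obtain f' g' where "f' \<in> ring_hull B" "g' \<in> ring_hull B"
      "\<forall>t\<in>S. (f has_vector_derivative f' t) (at t within S)"
      "\<forall>t\<in>S. (g has_vector_derivative g' t) (at t within S)" by blast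
    then show ?case
      by (intro bexI[OF _ ring_hull.add[of f' _ g']]) (auto intro: has_vector_derivative_add)
  next
    case (mult f g)
    then obtain f' g' where "f' \<in> ring_hull B" "g' \<in> ring_hull B"
      "\<forall>t\<in>S. (f has_vector_derivative f' t) (at t within S)"
      "\<forall>t\<in>S. (g has_vector_derivative g' t) (at t within S)" by blast
    with mult.hyps show ?case
      by (intro bexI[OF _ ring_hull.add[OF ring_hull.mult[of f _ g'] ring_hull.mult[of f' _ g]]])
        (auto intro: has_vector_derivative_mult)
  qed (rule step)
qed

lemma smooth_curve_on_ring_hull_smooth:
  assumes "f \<in> ring_hull {g. smooth_curve_on S g}"
  shows "smooth_curve_on S f"
  using _ assms
proof (rule smooth_curve_on_ring_hull)
  fix g :: "real \<Rightarrow> real" assume "g \<in> {g. smooth_curve_on S g}"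
  then have "smooth_curve_on S g" by simp
  then show "\<exists>g'\<in>ring_hull {g. smooth_curve_on S g}. \<forall>t\<in>S. (g has_vector_derivative g' t) (at t within S)"
    by (rule smooth_curve_onE) (auto intro: ring_hull.base)
qed

lemma
  fixes f g :: "real \<Rightarrow> real"
  assumes "smooth_curve_on S f" "smooth_curve_on S g"
  shows smooth_curve_on_add: "smooth_curve_on S (\<lambda>t. f t + g t)"
    and smooth_curve_on_mult: "smooth_curve_on S (\<lambda>t. f t * g t)"
proof -
  have *: "f \<in> ring_hull {h. smooth_curve_on S h}" "g \<in> ring_hull {h. smooth_curve_on S h}"
    using assms by (simp_all add: ring_hull.base)
  show "smooth_curve_on S (\<lambda>t. f t + g t)" "smooth_curve_on S (\<lambda>t. f t * g t)"
    by (rule smooth_curve_on_ring_hull_smooth[OF ring_hull.add[OF *]],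
        rule smooth_curve_on_ring_hull_smooth[OF ring_hull.mult[OF *]])
qed

lemma smooth_curve_on_sum:
  fixes f :: "'i \<Rightarrow> real \<Rightarrow> real"
  assumes "\<And>i. i \<in> J \<Longrightarrow> smooth_curve_on S (f i)"
  shows "smooth_curve_on S (\<lambda>t. \<Sum>i\<in>J. f i t)"
  using assms by (induction J rule: infinite_finite_induct) (auto intro: smooth_curve_on_add)

text \<open>The derivative \<open>g' * p'(g)\<close> is a smooth function times another composite.
  Composites alone are therefore not closed under derivatives, but the ring generated by them and
  the smooth functions on \<open>S\<close> is.\<close>

lemma smooth_curve_on_compose:
  fixes p g :: "real \<Rightarrow> real"
  assumes "smooth_curve_on T p" "smooth_curve_on S g" "g ` S \<subseteq> T"
  shows "smooth_curve_on S (\<lambda>t. p (g t))"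
proof -
  let ?B = "{f. smooth_curve_on S f} \<union> {\<lambda>t. p (g t) | p. smooth_curve_on T p}"
  from assms(2) obtain g' where g': "smooth_curve_on S g'"
    "\<forall>t\<in>S. (g has_vector_derivative g' t) (at t within S)"
    by (rule smooth_curve_onE)
  have "\<exists>h'\<in>ring_hull ?B. \<forall>t\<in>S. (h has_vector_derivative h' t) (at t within S)" if h: "h \<in> ?B" for h
  proof (cases "smooth_curve_on S h")
    case True
    then show ?thesis
      by (rule smooth_curve_onE) (auto intro: ring_hull.base)
  next
    case False
    with h obtain p where h: "h = (\<lambda>t. p (g t))" and p: "smooth_curve_on T p" by blast
    from p obtain p' where p': "smooth_curve_on T p'"
      "\<forall>t\<in>T. (p has_vector_derivative p' t) (at t within T)"
      by (rule smooth_curve_onE)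
    show ?thesis
    proof (intro bexI ballI)
      show "(\<lambda>t. g' t * p' (g t)) \<in> ring_hull ?B"
        by (intro ring_hull.mult; rule ring_hull.base) (use g'(1) p'(1) in auto)
      fix t assume t: "t \<in> S"
      have "(p has_vector_derivative p' (g t)) (at (g t) within g ` S)"
        by (rule has_vector_derivative_within_subset[OF bspec[OF p'(2)]]) (use assms(3) t in auto)
      from vector_diff_chain_within[OF bspec[OF g'(2) t] this]
      show "(h has_vector_derivative g' t * p' (g t)) (at t within S)"
        by (simp add: h o_def)
    qed
  qed
  then show ?thesis
    by (rule smooth_curve_on_ring_hull) (use assms(1) in \<open>auto intro: ring_hull.base\<close>)
qed

section \<open>A smooth function vanishing exactly on a half-line\<close>

text \<open>\<open>flat 0\<close> is the classical \<open>exp (-1/x)\<close> extended by 0. The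
  powers of \<open>1/x\<close> are included because differentiation produces them: the derivative of
  \<open>flat k\<close> is a linear combination of \<open>flat (k + 1)\<close> and
  \<open>flat (k + 2)\<close>.\<close>

definition flat :: "nat \<Rightarrow> real \<Rightarrow> real" where
  "flat k x = (if x \<le> 0 then 0 else inverse x ^ k * exp (- inverse x))"

text \<open>From the right, substituting \<open>inverse x\<close> reduces the limit to the fact that
  the exponential outgrows every power; from the left the function is 0.\<close>

lemma tendsto_flat: "(flat k \<longlongrightarrow> 0) (at 0)"
proof -
  have "((\<lambda>x. inverse x ^ k / exp (inverse x)) \<longlongrightarrow> (0::real)) (at_right 0)"
    by (rule filterlim_compose[OF tendsto_power_div_exp_0 filterlim_inverse_at_top_right])
  moreover have "\<forall>\<^sub>F x in at_right 0. inverse x ^ k / exp (inverse x) = flat k (x::real)"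
    unfolding eventually_at_right_field
    by (intro exI[of _ 1]) (auto simp: flat_def exp_minus field_simps)
  ultimately have r: "(flat k \<longlongrightarrow> 0) (at_right 0)"
    by (rule Lim_transform_eventually)
  have "\<forall>\<^sub>F x in at_left 0. 0 = flat k (x::real)"
    unfolding eventually_at_left_field by (intro exI[of _ "-1"]) (auto simp: flat_def)
  then have l: "(flat k \<longlongrightarrow> 0) (at_left 0)"
    by (rule Lim_transform_eventually[OF tendsto_const])
  from l r show ?thesis by (rule filterlim_split_at)
qed

lemma flat_has_derivative:
  "(flat k has_vector_derivative flat (k + 2) x + (- real k) * flat (k + 1) x) (at x)"
proof -
  consider "x < 0" | "x = 0" | "x > 0" by linarith
  then show ?thesis
  proof cases
    case 1
    have "(flat k has_vector_derivative 0) (at x)"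
      by (rule has_vector_derivative_transform_within_open[OF has_vector_derivative_const[of 0], of "{..<0}"])
        (use 1 in \<open>auto simp: flat_def\<close>)
    then show ?thesis using 1 by (simp add: flat_def)
  next
    case 2
    \<comment> \<open>The difference quotient of \<open>flat k\<close> at 0 is
      \<open>flat (Suc k)\<close>.\<close>
    have "((\<lambda>y. (flat k y - flat k 0) / (y - 0)) \<longlongrightarrow> 0) (at 0)"
      by (rule Lim_transform_eventually[OF tendsto_flat[of "Suc k"]])
        (auto simp: flat_def field_simps eventually_at_filter)
    then have "(flat k has_field_derivative 0) (at 0)"
      unfolding has_field_derivative_iff by simp
    then show ?thesis
      using 2 by (simp add: flat_def has_real_derivative_iff_has_vector_derivative)
  next
    case 3
    \<comment> \<open>For \<open>k = 0\<close> the truncated exponent does no harm, since the factor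
      \<open>real k\<close> vanishes.\<close>
    have *: "real k * inverse x ^ (k - Suc 0) * inverse x = real k * inverse x ^ k"
      by (cases k) auto
    have "((\<lambda>y. inverse y ^ k * exp (- inverse y)) has_field_derivative
        inverse x ^ k * (exp (- inverse x) * (inverse x * inverse x)) +
        - (real k * inverse x ^ (k - Suc 0) * inverse x) * inverse x * exp (- inverse x)) (at x)"
      using 3 by (auto intro!: derivative_eq_intros simp: algebra_simps)
    also have "inverse x ^ k * (exp (- inverse x) * (inverse x * inverse x)) +
        - (real k * inverse x ^ (k - Suc 0) * inverse x) * inverse x * exp (- inverse x) =
        inverse x ^ (k + 2) * exp (- inverse x) + (- real k) * (inverse x ^ (k + 1) * exp (- inverse x))"
      unfolding * by (simp add: algebra_simps power2_eq_square power_add)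
    finally have "((\<lambda>y. inverse y ^ k * exp (- inverse y)) has_field_derivative
        inverse x ^ (k + 2) * exp (- inverse x) + (- real k) * (inverse x ^ (k + 1) * exp (- inverse x))) (at x)" .
    then have "(flat k has_field_derivative
        inverse x ^ (k + 2) * exp (- inverse x) + (- real k) * (inverse x ^ (k + 1) * exp (- inverse x))) (at x)"
      by (rule has_field_derivative_transform_within_open[of _ _ _ "{0<..}"])
        (use 3 in \<open>auto simp: flat_def\<close>)
    then show ?thesis
      using 3 by (simp add: flat_def has_real_derivative_iff_has_vector_derivative)
  qed
qed

lemma smooth_flat: "smooth_curve_on UNIV (flat k)"
proof (rule smooth_curve_on_ring_hull)
  show "flat k \<in> ring_hull (range flat)" by (intro ring_hull.base) auto
  fix g assume "g \<in> range flat"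
  then obtain k where g: "g = flat k" by blast
  have hull: "(\<lambda>x. flat (k + 2) x + (- real k) * flat (k + 1) x) \<in> ring_hull (range flat)"
    by (intro ring_hull.add ring_hull.mult ring_hull.const; intro ring_hull.base) auto
  then show "\<exists>g'\<in>ring_hull (range flat). \<forall>t\<in>UNIV. (g has_vector_derivative g' t) (at t)"
    unfolding g by (intro bexI[of _ "\<lambda>x. flat (k + 2) x + (- real k) * flat (k + 1) x"] ballI flat_has_derivative)
qed

section \<open>Simplices\<close>

lemma abs_coord_le_norm: "\<bar>coord x i\<bar> \<le> norm x"
proof -
  have "infsum (\<lambda>i. \<bar>coord x i\<bar>) {i} \<le> norm x"
    unfolding norm_l1_def by (rule infsum_mono_neutral) (auto intro: coord_summable)
  then show ?thesis by simp
qed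

lemma coord_diff: "coord (x - y) = (\<lambda>i. coord x i - coord y i)"
  unfolding minus_l1_aux coord_add_aux coord_uminus_aux by simp

lemma bounded_linear_coord: "bounded_linear (\<lambda>x. coord x i)"
  by (rule bounded_linear_intro[of _ 1])
    (auto simp: coord_add_aux coord_scaleR_aux abs_coord_le_norm)

lemma coord_summable_on: "coord x summable_on UNIV"
  by (rule abs_summable_summable) (simp add: coord_summable)

lemma bounded_linear_infsum_coord: "bounded_linear (\<lambda>x. \<Sum>\<^sub>\<infinity>i. coord x i)"
proof (rule bounded_linear_intro[of _ 1])
  fix x y :: "'a l1" and r :: real
  show "(\<Sum>\<^sub>\<infinity>i. coord (x + y) i) = (\<Sum>\<^sub>\<infinity>i. coord x i) + (\<Sum>\<^sub>\<infinity>i. coord y i)"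
    by (simp add: coord_add_aux infsum_add coord_summable_on)
  show "(\<Sum>\<^sub>\<infinity>i. coord (r *\<^sub>R x) i) = r *\<^sub>R (\<Sum>\<^sub>\<infinity>i. coord x i)"
    by (simp add: coord_scaleR_aux infsum_cmult_right')
  show "norm (\<Sum>\<^sub>\<infinity>i. coord x i) \<le> norm x * 1"
    using norm_infsum_bound[of "coord x" UNIV] by (simp add: norm_l1_def coord_summable)
qed

lemma coord_vertex: "coord (vertex i) j = (if j = i then 1 else 0)"
proof -
  have "(\<lambda>j. \<bar>if j = i then 1 else 0\<bar> :: real) summable_on UNIV"
    by (rule finite_nonzero_values_imp_summable_on) auto
  then show ?thesis by (simp add: vertex_def Abs_l1_inverse)
qed

lemma vertex_in_simplex: "i \<in> I \<Longrightarrow> vertex i \<in> std_simplex I"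
proof -
  have "infsum (coord (vertex i)) UNIV = (\<Sum>\<^sub>\<infinity>j\<in>{i}. 1)"
    by (rule infsum_cong_neutral) (auto simp: coord_vertex)
  then show "i \<in> I \<Longrightarrow> vertex i \<in> std_simplex I"
    by (auto simp: std_simplex_def coord_vertex)
qed

lemma diff_in_simplex_tangent:
  assumes "x \<in> std_simplex I" "y \<in> std_simplex I"
  shows "y - x \<in> simplex_tangent I"
  using assms linear_diff[OF bounded_linear.linear[OF bounded_linear_infsum_coord], of y x]
  by (simp add: std_simplex_def simplex_tangent_def coord_diff)

lemma scaleR_in_simplex_tangent: "v \<in> simplex_tangent I \<Longrightarrow> r *\<^sub>R v \<in> simplex_tangent I"
  by (simp add: simplex_tangent_def coord_scaleR_aux infsum_cmult_right')

lemma linepath_in_simplex: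
  assumes "x \<in> std_simplex I" "y \<in> std_simplex I" "t \<in> {0..1}"
  shows "linepath x y t \<in> std_simplex I"
  using assms
  by (auto simp: std_simplex_def linepath_def coord_add_aux coord_scaleR_aux
      infsum_add infsum_cmult_right' summable_on_cmult_right coord_summable_on)

text \<open>Each linear equation defining the simplex says that a bounded linear functional (the
  total sum, or a coordinate outside \<open>I\<close>) is constant on it. Such a functional is
  constant along \<open>c\<close>, so it kills the derivative.\<close>

lemma derivative_in_simplex_tangent:
  assumes c: "\<And>t. t \<in> {a..b} \<Longrightarrow> c t \<in> std_simplex I"
    and t: "a < b" "t \<in> {a..b}"
    and d: "(c has_vector_derivative v) (at t within {a..b})"
  shows "v \<in> simplex_tangent I"
proof -
  have "L v = 0" if L: "bounded_linear L" "\<And>x. x \<in> std_simplex I \<Longrightarrow> L x = r" for L :: "int l1 \<Rightarrow> real" and r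
  proof -
    have "((\<lambda>t. L (c t)) has_vector_derivative L v) (at t within {a..b})"
      using L(1) d by (rule bounded_linear.has_vector_derivative)
    moreover have "((\<lambda>t. L (c t)) has_vector_derivative 0) (at t within {a..b})"
      by (rule has_vector_derivative_transform[OF t(2) _ has_vector_derivative_const[of r]])
        (use c L in auto)
    ultimately show ?thesis
      using vector_derivative_unique_within_closed_interval[of a b t] t by (metis cbox_interval)
  qed
  from this[OF bounded_linear_infsum_coord, of 1] this[OF bounded_linear_coord, of _ 0]
  show ?thesis by (auto simp: std_simplex_def simplex_tangent_def)
qed

section \<open>Finiteness of the set of large coordinates\<close>

text \<open>If there were infinitely many, \<open>n\<close> of them would force the norm to be at
  least \<open>n * e\<close>, for every \<open>n\<close>.\<close>

lemma finite_large_coords: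
  fixes x :: "'i l1"
  assumes "0 < e"
  shows "finite {i. e < \<bar>coord x i\<bar>}"
proof (rule ccontr)
  assume inf: "infinite {i. e < \<bar>coord x i\<bar>}"
  obtain n :: nat where n: "norm x < real n * e"
    using assms ex_less_of_nat_mult by blast
  from inf obtain F where F: "F \<subseteq> {i. e < \<bar>coord x i\<bar>}" "finite F" "card F = n"
    using infinite_arbitrarily_large by blast
  have "real n * e \<le> (\<Sum>i\<in>F. \<bar>coord x i\<bar>)"
    using sum_bounded_below[of F e "\<lambda>i. \<bar>coord x i\<bar>"] F by (auto simp: less_imp_le subset_iff)
  also have "\<dots> \<le> norm x"
    unfolding norm_l1_def using F(2) by (intro finite_sum_le_infsum coord_summable) auto
  finally show False using n by simp
qed

text \<open>The image of the path is compact, hence covered by finitely many balls of radius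
  \<open>e/2\<close>. A coordinate exceeding \<open>e\<close> somewhere on the path exceeds
  \<open>e/2\<close> at the centre of such a ball, where only finitely many do.\<close>

lemma finite_large_coords_path:
  fixes c :: "real \<Rightarrow> 'i l1"
  assumes "continuous_on {0..1} c" "0 < e"
  shows "finite {i. \<exists>t\<in>{0..1}. e < \<bar>coord (c t) i\<bar>}"
proof -
  have "compact (c ` {0..1})" by (rule compact_continuous_image[OF assms(1)]) simp
  then have "\<forall>e>0. \<exists>k. finite k \<and> c ` {0..1} \<subseteq> (\<Union>x\<in>k. ball x e)"
    unfolding compact_eq_totally_bounded by (rule conjunct2)
  moreover have "e / 2 > 0" using assms(2) by simp
  ultimately obtain k where k: "finite k" "c ` {0..1} \<subseteq> (\<Union>x\<in>k. ball x (e/2))"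
    by blast
  have "{i. \<exists>t\<in>{0..1}. e < \<bar>coord (c t) i\<bar>} \<subseteq> (\<Union>x\<in>k. {i. e/2 < \<bar>coord x i\<bar>})"
  proof
    fix i assume "i \<in> {i. \<exists>t\<in>{0..1}. e < \<bar>coord (c t) i\<bar>}"
    then obtain t where t: "t \<in> {0..1}" "e < \<bar>coord (c t) i\<bar>" by blast
    then have "c t \<in> (\<Union>x\<in>k. ball x (e/2))" using k(2) by blast
    then obtain x where x: "x \<in> k" "dist x (c t) < e/2" by auto
    have "\<bar>coord x i - coord (c t) i\<bar> \<le> dist x (c t)"
      using abs_coord_le_norm[of "x - c t" i] by (simp add: dist_norm coord_diff)
    with x t have "e/2 < \<bar>coord x i\<bar>" by linarith
    with x show "i \<in> (\<Union>x\<in>k. {i. e/2 < \<bar>coord x i\<bar>})" by blast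
  qed
  then show ?thesis
    by (rule finite_subset) (intro finite_UN_I k(1) finite_large_coords half_gt_zero assms(2))
qed

section \<open>Logarithmic derivatives in Froelicher groups\<close>

lemma has_real_derivative_transform:
  assumes "x \<in> S" "\<And>x. x \<in> S \<Longrightarrow> g x = f x" "(f has_real_derivative D) (at x within S)"
  shows "(g has_real_derivative D) (at x within S)"
  using has_vector_derivative_transform[of x S g f D] assms
  by (simp add: has_real_derivative_iff_has_vector_derivative)

context
  fixes G :: "('g, 'm) frolicher_monoid_scheme"
  assumes frolicher: "frolicher_group G"
begin

interpretation group G
  using frolicher by (simp add: frolicher_group_def)

lemmas curves_eq = frolicher[unfolded frolicher_group_def, THEN conjunct2, THEN conjunct1]
  and funs_eq = frolicher[unfolded frolicher_group_def, THEN conjunct2, THEN conjunct2, THEN conjunct1]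
  and curves_mult = frolicher[unfolded frolicher_group_def, THEN conjunct2, THEN conjunct2, THEN conjunct2,
    THEN conjunct1]

lemma const_in_curves: "g \<in> carrier G \<Longrightarrow> (\<lambda>_. g) \<in> curves G"
  by (subst curves_eq) simp

text \<open>By \<open>funs_eq\<close> smoothness is tested along smooth curves, and the product of
  such a curve with a constant curve is again smooth.\<close>

lemma funs_right_translate:
  assumes "f \<in> funs G" "g \<in> carrier G"
  shows "(\<lambda>x. f (x \<otimes>\<^bsub>G\<^esub> g)) \<in> funs G"
proof -
  have "smooth_curve_on UNIV (\<lambda>t. f (c t \<otimes>\<^bsub>G\<^esub> g))" if "c \<in> curves G" for c
    using assms(1) curves_mult that const_in_curves[OF assms(2)] by (subst (asm) funs_eq) simp
  then show ?thesis by (subst funs_eq) simp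
qed

lemma smooth_group_path_right_translate:
  assumes "smooth_group_path G S u" "g \<in> carrier G"
  shows "smooth_group_path G S (\<lambda>t. u t \<otimes>\<^bsub>G\<^esub> g)"
  using assms funs_right_translate[OF _ assms(2)] unfolding smooth_group_path_def by auto

text \<open>The factor \<open>g\<close> cancels in the quotient of two values of the path. This
  invariance allows the initial value of a lift to be changed at will.\<close>

lemma log_derivative_right_translate:
  assumes "log_derivative G S u v" "u ` S \<subseteq> carrier G" "g \<in> carrier G"
  shows "log_derivative G S (\<lambda>t. u t \<otimes>\<^bsub>G\<^esub> g) v"
  unfolding log_derivative_def
proof (intro ballI)
  fix t f assume t: "t \<in> S" "f \<in> funs G"
  have eq: "u s \<otimes>\<^bsub>G\<^esub> g \<otimes>\<^bsub>G\<^esub> inv\<^bsub>G\<^esub> (u t \<otimes>\<^bsub>G\<^esub> g) = u s \<otimes>\<^bsub>G\<^esub> inv\<^bsub>G\<^esub> (u t)" if "s \<in> S" for s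
  proof -
    have c: "u s \<in> carrier G" "u t \<in> carrier G" using assms(2) t that by auto
    have "u s \<otimes>\<^bsub>G\<^esub> g \<otimes>\<^bsub>G\<^esub> inv\<^bsub>G\<^esub> (u t \<otimes>\<^bsub>G\<^esub> g) = u s \<otimes>\<^bsub>G\<^esub> (g \<otimes>\<^bsub>G\<^esub> inv\<^bsub>G\<^esub> g) \<otimes>\<^bsub>G\<^esub> inv\<^bsub>G\<^esub> (u t)"
      using c assms(3) by (simp only: inv_mult_group m_assoc m_closed inv_closed)
    then show ?thesis using c assms(3) by simp
  qed
  have "((\<lambda>s. f (u s \<otimes>\<^bsub>G\<^esub> inv\<^bsub>G\<^esub> (u t))) has_real_derivative v t f) (at t within S)"
    using assms(1) t unfolding log_derivative_def by blast
  then show "((\<lambda>s. f (u s \<otimes>\<^bsub>G\<^esub> g \<otimes>\<^bsub>G\<^esub> inv\<^bsub>G\<^esub> (u t \<otimes>\<^bsub>G\<^esub> g))) has_real_derivative v t f) (at t within S)"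
    by (rule has_real_derivative_transform[OF t(1), rotated]) (simp only: eq)
qed

end

lemma smooth_group_path_reparam:
  assumes "smooth_group_path G T u" "smooth_curve_on S p" "p ` S \<subseteq> T"
  shows "smooth_group_path G S (\<lambda>t. u (p t))"
  using assms smooth_curve_on_compose[OF _ assms(2,3)] unfolding smooth_group_path_def
  by blast

lemma log_derivative_reparam:
  assumes "log_derivative G T u v" "p ` S \<subseteq> T"
    and p: "\<And>t. t \<in> S \<Longrightarrow> (p has_real_derivative p' t) (at t within S)"
  shows "log_derivative G S (\<lambda>t. u (p t)) (\<lambda>t f. p' t * v (p t) f)"
  unfolding log_derivative_def
proof (intro ballI)
  fix t f assume t: "t \<in> S" "f \<in> funs G"
  then have "((\<lambda>s. f (u s \<otimes>\<^bsub>G\<^esub> inv\<^bsub>G\<^esub> (u (p t)))) has_real_derivative v (p t) f) (at (p t) within T)"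
    using assms(1,2) unfolding log_derivative_def by blast
  then have "((\<lambda>s. f (u s \<otimes>\<^bsub>G\<^esub> inv\<^bsub>G\<^esub> (u (p t)))) has_real_derivative v (p t) f) (at (p t) within p ` S)"
    using assms(2) by (rule DERIV_subset)
  from DERIV_image_chain[OF this p[OF t(1)]]
  show "((\<lambda>s. f (u (p s) \<otimes>\<^bsub>G\<^esub> inv\<^bsub>G\<^esub> (u (p t)))) has_real_derivative p' t * v (p t) f) (at t within S)"
    by (simp add: o_def mult.commute)
qed

lemma smooth_group_path_cong:
  assumes "smooth_group_path G S u" "\<And>t. t \<in> S \<Longrightarrow> w t = u t"
  shows "smooth_group_path G S w"
  unfolding smooth_group_path_def
proof (intro conjI ballI)
  show "w ` S \<subseteq> carrier G"
    using assms unfolding smooth_group_path_def by auto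
  fix f assume "f \<in> funs G"
  with assms(1) have "smooth_curve_on S (\<lambda>t. f (u t))"
    unfolding smooth_group_path_def by blast
  then show "smooth_curve_on S (\<lambda>t. f (w t))"
    by (rule smooth_curve_on_cong) (simp add: assms(2))
qed

lemma log_derivative_cong:
  assumes "log_derivative G S u v" "\<And>t. t \<in> S \<Longrightarrow> w t = u t" "\<And>t. t \<in> S \<Longrightarrow> v' t = v t"
  shows "log_derivative G S w v'"
  unfolding log_derivative_def
proof (intro ballI)
  fix t f assume t: "t \<in> S" "f \<in> funs G"
  then have "((\<lambda>s. f (u s \<otimes>\<^bsub>G\<^esub> inv\<^bsub>G\<^esub> (u t))) has_real_derivative v t f) (at t within S)"
    using assms(1) unfolding log_derivative_def by blast
  then show "((\<lambda>s. f (w s \<otimes>\<^bsub>G\<^esub> inv\<^bsub>G\<^esub> (w t))) has_real_derivative v' t f) (at t within S)"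
    unfolding assms(3)[OF t(1)]
    by (rule has_real_derivative_transform[OF t(1), rotated]) (simp add: assms(2) t(1))
qed

section \<open>Horizontal lifts and holonomy\<close>

text \<open>Induction on the break points: one inside the interval splits it into two pieces with
  fewer break points, and \<open>trans\<close> glues them. It carries facts about smooth pieces over
  to piecewise smooth paths.\<close>

lemma break_points_induct:
  fixes a b :: real
  assumes "finite P" "a < b"
    and "\<And>x y. a \<le> x \<Longrightarrow> x < y \<Longrightarrow> y \<le> b \<Longrightarrow> {x<..<y} \<inter> P = {} \<Longrightarrow> E x y"
    and trans: "\<And>x y z. E x y \<Longrightarrow> E y z \<Longrightarrow> E x z"
  shows "E a b"
  using assms(1-3)
proof (induction P arbitrary: a b)
  case empty
  then show ?case by auto
next
  case (insert r P)
  show ?case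
  proof (cases "r \<in> {a<..<b}")
    case True
    have "E a r"
      by (rule insert.IH) (use True in \<open>auto intro!: insert.prems(2)\<close>)
    moreover have "E r b"
      by (rule insert.IH) (use True in \<open>auto intro!: insert.prems(2)\<close>)
    ultimately show ?thesis by (rule trans)
  next
    case False
    show ?thesis
      by (rule insert.IH[OF insert.prems(1)]) (use False in \<open>auto intro!: insert.prems(2)\<close>)
  qed
qed

section \<open>Lifts over smooth pieces\<close>

text \<open>The velocity \<open>c'\<close> is passed as data, not as a
  \<open>vector_derivative\<close>, whose value depends on the set within which it is taken;
  restriction and reparametrization then just transport it. The membership conditions make linearity
  and smoothness of the form applicable.\<close>

definition lift_on ::
  "('g, 'm) frolicher_monoid_scheme \<Rightarrow> int set \<Rightarrow> (int l1 \<Rightarrow> int l1 \<Rightarrow> 'g tvec) \<Rightarrow> real set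
    \<Rightarrow> (real \<Rightarrow> int l1) \<Rightarrow> (real \<Rightarrow> int l1) \<Rightarrow> (real \<Rightarrow> 'g) \<Rightarrow> bool" where
  "lift_on G I \<theta> S c c' u \<longleftrightarrow>
     c ` S \<subseteq> std_simplex I \<and> c' ` S \<subseteq> simplex_tangent I \<and>
     smooth_curve_on S c \<and> smooth_curve_on S c' \<and>
     (\<forall>t\<in>S. (c has_vector_derivative c' t) (at t within S)) \<and>
     smooth_group_path G S u \<and> log_derivative G S u (\<lambda>t f. - \<theta> (c t) (c' t) f)"

lemma lift_on_cong:
  assumes "lift_on G I \<theta> S c c' u"
    and "\<And>t. t \<in> S \<Longrightarrow> d t = c t" "\<And>t. t \<in> S \<Longrightarrow> d' t = c' t" "\<And>t. t \<in> S \<Longrightarrow> w t = u t"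
  shows "lift_on G I \<theta> S d d' w"
  unfolding lift_on_def
proof (intro conjI ballI)
  note l = assms(1)[unfolded lift_on_def]
  show "d ` S \<subseteq> std_simplex I" "d' ` S \<subseteq> simplex_tangent I"
    using l assms(2,3) by (auto simp: image_subset_iff)
  show "smooth_curve_on S d" "smooth_curve_on S d'"
    by (rule smooth_curve_on_cong[of S c] smooth_curve_on_cong[of S c'], use l assms(2,3) in simp_all)+
  show "smooth_group_path G S w"
    by (rule smooth_group_path_cong[of G S u]) (use l assms(4) in simp_all)
  show "log_derivative G S w (\<lambda>t f. - \<theta> (d t) (d' t) f)"
    by (rule log_derivative_cong[of G S u "\<lambda>t f. - \<theta> (c t) (c' t) f"]) (use l assms(2-4) in auto)
  fix t assume t: "t \<in> S"
  show "(d has_vector_derivative d' t) (at t within S)"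
    unfolding assms(3)[OF t] by (rule has_vector_derivative_transform[OF t assms(2)]) (use l t in auto)
qed

lemma vector_derivative_within_interval:
  fixes a b :: real
  assumes "a < b" "t \<in> {a..b}" "(c has_vector_derivative v) (at t within {a..b})"
  shows "vector_derivative c (at t within {a..b}) = v"
  using vector_derivative_within_cbox[of a b t c v] assms by (simp add: cbox_interval)

lemma lift_onI_vector_derivative:
  assumes ab: "a < b" and c: "c ` {a..b} \<subseteq> std_simplex I" "smooth_curve_on {a..b} c"
    and u: "smooth_group_path G {a..b} u"
      "log_derivative G {a..b} u (\<lambda>t f. - \<theta> (c t) (vector_derivative c (at t within {a..b})) f)"
  shows "lift_on G I \<theta> {a..b} c (\<lambda>t. vector_derivative c (at t within {a..b})) u"
proof -
  from c(2) obtain c' where c': "smooth_curve_on {a..b} c'"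
    "\<forall>t\<in>{a..b}. (c has_vector_derivative c' t) (at t within {a..b})"
    by (rule smooth_curve_onE)
  have eq: "vector_derivative c (at t within {a..b}) = c' t" if "t \<in> {a..b}" for t
    by (rule vector_derivative_within_interval[OF ab that bspec[OF c'(2) that]])
  have "c' t \<in> simplex_tangent I" if "t \<in> {a..b}" for t
    by (rule derivative_in_simplex_tangent[OF _ ab that bspec[OF c'(2) that]]) (use c(1) in auto)
  then have "(\<lambda>t. vector_derivative c (at t within {a..b})) ` {a..b} \<subseteq> simplex_tangent I"
    using eq by auto
  moreover have "smooth_curve_on {a..b} (\<lambda>t. vector_derivative c (at t within {a..b}))"
    by (rule smooth_curve_on_cong[OF c'(1) eq])
  ultimately show ?thesis
    unfolding lift_on_def using c u c'(2) eq by auto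
qed

lemma horizontal_liftI:
  assumes "finite P"
    and "\<And>a b. 0 \<le> a \<Longrightarrow> a < b \<Longrightarrow> b \<le> 1 \<Longrightarrow> {a<..<b} \<inter> P = {} \<Longrightarrow> \<exists>c'. lift_on G I \<theta> {a..b} c c' u"
  shows "horizontal_lift G \<theta> c u"
  unfolding horizontal_lift_def
proof (intro exI[of _ P] conjI allI impI assms(1); elim conjE)
  fix a b :: real
  assume ab: "0 \<le> a" "a < b" "b \<le> 1" "{a<..<b} \<inter> P = {}"
  then obtain c' where l: "lift_on G I \<theta> {a..b} c c' u" using assms(2) by blast
  then show "smooth_curve_on {a..b} c" "smooth_group_path G {a..b} u"
    by (auto simp: lift_on_def)
  have eq: "vector_derivative c (at t within {a..b}) = c' t" if "t \<in> {a..b}" for t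
    by (rule vector_derivative_within_interval[OF ab(2) that]) (use l that in \<open>auto simp: lift_on_def\<close>)
  show "log_derivative G {a..b} u (\<lambda>t f. - \<theta> (c t) (vector_derivative c (at t within {a..b})) f)"
    by (rule log_derivative_cong[of G _ u "\<lambda>t f. - \<theta> (c t) (c' t) f"])
      (use l eq in \<open>auto simp: lift_on_def\<close>)
qed

lemma horizontal_liftE:
  assumes "horizontal_lift G \<theta> c u" "c ` {0..1} \<subseteq> std_simplex I"
  obtains P where "finite P"
    "\<And>a b. 0 \<le> a \<Longrightarrow> a < b \<Longrightarrow> b \<le> 1 \<Longrightarrow> {a<..<b} \<inter> P = {} \<Longrightarrow>
       lift_on G I \<theta> {a..b} c (\<lambda>t. vector_derivative c (at t within {a..b})) u"
proof -
  from assms(1) obtain P where P: "finite P"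
    "\<And>a b. 0 \<le> a \<Longrightarrow> a < b \<Longrightarrow> b \<le> 1 \<Longrightarrow> {a<..<b} \<inter> P = {} \<Longrightarrow>
       smooth_curve_on {a..b} c \<and> smooth_group_path G {a..b} u \<and>
       log_derivative G {a..b} u (\<lambda>t f. - \<theta> (c t) (vector_derivative c (at t within {a..b})) f)"
    unfolding horizontal_lift_def by blast
  show thesis
  proof (rule that[OF P(1)])
    fix a b :: real
    assume ab: "0 \<le> a" "a < b" "b \<le> 1" "{a<..<b} \<inter> P = {}"
    have "c ` {a..b} \<subseteq> std_simplex I"
      using assms(2) ab by (auto simp: image_subset_iff)
    with P(2)[OF ab] show "lift_on G I \<theta> {a..b} c (\<lambda>t. vector_derivative c (at t within {a..b})) u"
      by (intro lift_onI_vector_derivative ab(2)) auto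
  qed
qed

lemma lie_alg_lincomb:
  assumes "frolicher_lie_group G" "X \<in> lie_alg G" "Y \<in> lie_alg G"
  shows "(\<lambda>f. a * X f + b * Y f) \<in> lie_alg G"
  using assms unfolding frolicher_lie_group_def by blast

lemma lie_alg_scale:
  assumes "frolicher_lie_group G" "X \<in> lie_alg G"
  shows "(\<lambda>f. a * X f) \<in> lie_alg G"
  using lie_alg_lincomb[OF assms assms(2), of a 0] by simp

lemma smooth_alg_path_uminus:
  assumes "frolicher_lie_group G" "smooth_alg_path G S v"
  shows "smooth_alg_path G S (\<lambda>t f. - v t f)"
  using assms(2) lie_alg_scale[OF assms(1), of _ "-1"]
    smooth_curve_on_bounded_linear[OF bounded_linear_minus[OF bounded_linear_ident], where ?'b = real]
  unfolding smooth_alg_path_def by (simp add: image_subset_iff)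

section \<open>Transport and uniqueness of lifts for a fixed connection\<close>

locale connection =
  fixes G :: "('g, 'm) frolicher_monoid_scheme" (structure) and I :: "int set"
    and \<theta> :: "int l1 \<Rightarrow> int l1 \<Rightarrow> 'g tvec"
  assumes lie: "frolicher_lie_group G" and solvable: "log_solvable G"
    and form: "\<theta> \<in> one_forms G I"
begin

lemma frolicher: "frolicher_group G"
  using lie by (simp add: frolicher_lie_group_def)

sublocale group G
  using frolicher by (simp add: frolicher_group_def)

lemma form_scale:
  assumes "x \<in> std_simplex I" "v \<in> simplex_tangent I"
  shows "\<theta> x (r *\<^sub>R v) f = r * \<theta> x v f"
proof -
  have "\<theta> x (r *\<^sub>R v + 0 *\<^sub>R v) = (\<lambda>f. r * \<theta> x v f + 0 * \<theta> x v f)"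
    using form assms unfolding one_forms_def by blast
  then show ?thesis by simp
qed

lemma smooth_alg_path_form:
  assumes "smooth_curve_on {0..1} c" "smooth_curve_on {0..1} w"
    and "c ` {0..1} \<subseteq> std_simplex I" "w ` {0..1} \<subseteq> simplex_tangent I"
  shows "smooth_alg_path G {0..1} (\<lambda>t f. - \<theta> (c t) (w t) f)"
  by (rule smooth_alg_path_uminus[OF lie]) (use form assms in \<open>unfold one_forms_def, blast\<close>)

lemma lift_on_right_translate:
  assumes "lift_on G I \<theta> S c c' u" "g \<in> carrier G"
  shows "lift_on G I \<theta> S c c' (\<lambda>t. u t \<otimes> g)"
proof -
  note l = assms(1)[unfolded lift_on_def]
  then have "u ` S \<subseteq> carrier G" by (simp add: smooth_group_path_def)
  with l show ?thesis
    unfolding lift_on_def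
    by (simp add: assms(2) smooth_group_path_right_translate[OF frolicher]
        log_derivative_right_translate[OF frolicher])
qed

text \<open>The factor \<open>m\<close> from the chain rule is absorbed by the linearity of the form
  in its second argument. The sign of \<open>m\<close> is free: \<open>m = 1\<close> gives
  restriction, \<open>m = 2\<close> the two halves of a concatenation, \<open>m = -1\<close>
  reversal.\<close>

lemma lift_on_affine:
  assumes l: "lift_on G I \<theta> T c c' u" and T: "\<And>t. t \<in> S \<Longrightarrow> m * t + k \<in> T"
  shows "lift_on G I \<theta> S (\<lambda>t. c (m * t + k)) (\<lambda>t. m *\<^sub>R c' (m * t + k)) (\<lambda>t. u (m * t + k))"
  unfolding lift_on_def
proof (intro conjI ballI)
  note l = l[unfolded lift_on_def]
  have T': "(\<lambda>t. m * t + k) ` S \<subseteq> T" using T by blast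
  have p: "((\<lambda>t. m * t + k) has_real_derivative m) (at t within S)" for t
    by (auto intro!: derivative_eq_intros)
  show "(\<lambda>t. c (m * t + k)) ` S \<subseteq> std_simplex I"
    "(\<lambda>t. m *\<^sub>R c' (m * t + k)) ` S \<subseteq> simplex_tangent I"
    using l T by (auto intro!: scaleR_in_simplex_tangent)
  show "smooth_curve_on S (\<lambda>t. c (m * t + k))"
    by (rule smooth_curve_on_affine[of T]) (use l T in auto)
  show "smooth_curve_on S (\<lambda>t. m *\<^sub>R c' (m * t + k))"
    by (rule smooth_curve_on_bounded_linear[OF bounded_linear_scaleR_right],
        rule smooth_curve_on_affine[of T]) (use l T in auto)
  have "smooth_curve_on S (\<lambda>t. m * t + k)"
    by (rule smooth_curve_onI[of S "\<lambda>_. m"])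
      (use p in \<open>auto simp: has_real_derivative_iff_has_vector_derivative\<close>)
  then show "smooth_group_path G S (\<lambda>t. u (m * t + k))"
    by (rule smooth_group_path_reparam[OF _ _ T', rotated]) (use l in simp)
  have "log_derivative G S (\<lambda>t. u (m * t + k)) (\<lambda>t f. m * - \<theta> (c (m * t + k)) (c' (m * t + k)) f)"
    by (rule log_derivative_reparam[OF _ T' p]) (use l in blast)
  then show "log_derivative G S (\<lambda>t. u (m * t + k)) (\<lambda>t f. - \<theta> (c (m * t + k)) (m *\<^sub>R c' (m * t + k)) f)"
    by (rule log_derivative_cong) (use l T in \<open>auto simp: form_scale image_subset_iff\<close>)
  fix t assume t: "t \<in> S"
  have "(c has_vector_derivative c' (m * t + k)) (at (m * t + k) within (\<lambda>t. m * t + k) ` S)"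
    by (rule has_vector_derivative_within_subset[OF _ T']) (use l T t in blast)
  with p[of t] show "((\<lambda>t. c (m * t + k)) has_vector_derivative m *\<^sub>R c' (m * t + k)) (at t within S)"
    using vector_diff_chain_within[of "\<lambda>t. m * t + k" m t S c "c' (m * t + k)"]
    by (simp add: o_def has_real_derivative_iff_has_vector_derivative)
qed

lemma lift_on_subset:
  assumes "lift_on G I \<theta> T c c' u" "S \<subseteq> T"
  shows "lift_on G I \<theta> S c c' u"
  using lift_on_affine[OF assms(1), of S 1 0] assms(2) by auto

text \<open>\<open>log_solvable\<close> speaks of solutions on \<open>{0..1}\<close> that start at
  the unit. Both lifts are brought into this form by the affine map of \<open>{0..1}\<close> onto
  \<open>{a..b}\<close> and by right translation with the inverse of their initial value.\<close>

lemma lift_on_unique: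
  assumes u: "lift_on G I \<theta> {a..b} c c' u" and w: "lift_on G I \<theta> {a..b} c c' w"
    and ab: "a < b" "u a = w a"
  shows "u b = w b"
proof -
  let ?p = "\<lambda>t. (b - a) * t + a"
  have p: "?p t \<in> {a..b}" if "t \<in> {0..1}" for t
  proof -
    have "(b - a) * t \<le> b - a" "0 \<le> (b - a) * t" using that ab(1) by (auto intro: mult_left_le)
    then show ?thesis unfolding atLeastAtMost_iff by linarith
  qed
  let ?v = "\<lambda>t f. - \<theta> (c (?p t)) ((b - a) *\<^sub>R c' (?p t)) f"
  have carrier: "z t \<in> carrier G" if "lift_on G I \<theta> {a..b} c c' z" "t \<in> {a..b}" for z t
    using that by (auto simp: lift_on_def smooth_group_path_def)
  have *: "lift_on G I \<theta> {0..1} (\<lambda>t. c (?p t)) (\<lambda>t. (b - a) *\<^sub>R c' (?p t)) (\<lambda>t. z (?p t) \<otimes> inv (z a))"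
    if "lift_on G I \<theta> {a..b} c c' z" for z
    by (rule lift_on_right_translate[OF lift_on_affine[OF that p]]) (use carrier[OF that] ab in auto)
  have sol: "solves_log G ?v (\<lambda>t. z (?p t) \<otimes> inv (z a))" if "lift_on G I \<theta> {a..b} c c' z" for z
    using *[OF that] carrier[OF that, of a] ab by (simp add: solves_log_def lift_on_def)
  have "smooth_alg_path G {0..1} ?v"
    by (rule smooth_alg_path_form) (use *[OF u] in \<open>auto simp: lift_on_def\<close>)
  with solvable obtain y where y: "\<forall>z. solves_log G ?v z \<longrightarrow> (\<forall>t\<in>{0..1}. z t = y t)"
    unfolding log_solvable_def by blast
  have "u (?p 1) \<otimes> inv (u a) = w (?p 1) \<otimes> inv (w a)"
    using y[rule_format, OF sol[OF u], of 1] y[rule_format, OF sol[OF w], of 1] by simp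
  then show ?thesis
    using carrier[OF u] carrier[OF w] ab by simp
qed

section \<open>Holonomy of paths, concatenations and reversals\<close>

text \<open>A relational form of \<open>Hol\<close> that separates existence of a lift from
  uniqueness. Composition rules can be proved by exhibiting lifts; \<open>Hol_eq\<close> then
  evaluates the definite description once and for all.\<close>

definition has_hol :: "(real \<Rightarrow> int l1) \<Rightarrow> 'g \<Rightarrow> bool" where
  "has_hol c g \<longleftrightarrow> c ` {0..1} \<subseteq> std_simplex I \<and>
     (\<exists>u. horizontal_lift G \<theta> c u \<and> u 0 = \<one> \<and> u 1 = g)"

lemma horizontal_lift_in_carrier:
  assumes "horizontal_lift G \<theta> c u" "c ` {0..1} \<subseteq> std_simplex I"
  shows "u 1 \<in> carrier G"
proof (rule horizontal_liftE[OF assms])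
  fix P :: "real set"
  assume P: "finite P" "\<And>a b. 0 \<le> a \<Longrightarrow> a < b \<Longrightarrow> b \<le> 1 \<Longrightarrow> {a<..<b} \<inter> P = {} \<Longrightarrow>
       lift_on G I \<theta> {a..b} c (\<lambda>t. vector_derivative c (at t within {a..b})) u"
  show ?thesis
  \<comment> \<open>The relation ignores its left argument: each smooth piece already places its
    right end in the carrier.\<close>
  proof (rule break_points_induct[of P 0 1 "\<lambda>_ y. u y \<in> carrier G"])
    fix x y :: real
    assume "0 \<le> x" "x < y" "y \<le> 1" "{x<..<y} \<inter> P = {}"
    then show "u y \<in> carrier G"
      using P(2)[of x y] by (auto simp: lift_on_def smooth_group_path_def)
  qed (use P(1) in auto)
qed

lemma has_hol_in_carrier: "has_hol c g \<Longrightarrow> g \<in> carrier G"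
  using horizontal_lift_in_carrier by (auto simp: has_hol_def)

lemma horizontal_lift_unique:
  assumes "horizontal_lift G \<theta> c u" "horizontal_lift G \<theta> c w" "u 0 = w 0"
    and c: "c ` {0..1} \<subseteq> std_simplex I"
  shows "u 1 = w 1"
proof (rule horizontal_liftE[OF assms(1) c], rule horizontal_liftE[OF assms(2) c])
  fix P Q :: "real set"
  assume P: "finite P" "\<And>a b. 0 \<le> a \<Longrightarrow> a < b \<Longrightarrow> b \<le> 1 \<Longrightarrow> {a<..<b} \<inter> P = {} \<Longrightarrow>
       lift_on G I \<theta> {a..b} c (\<lambda>t. vector_derivative c (at t within {a..b})) u"
    and Q: "finite Q" "\<And>a b. 0 \<le> a \<Longrightarrow> a < b \<Longrightarrow> b \<le> 1 \<Longrightarrow> {a<..<b} \<inter> Q = {} \<Longrightarrow>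
       lift_on G I \<theta> {a..b} c (\<lambda>t. vector_derivative c (at t within {a..b})) w"
  have "u 0 = w 0 \<longrightarrow> u 1 = w 1"
  \<comment> \<open>The two lifts may come with different break points; the union is a common
    refinement.\<close>
  proof (rule break_points_induct[of "P \<union> Q" 0 1 "\<lambda>x y. u x = w x \<longrightarrow> u y = w y"])
    fix x y :: real
    assume xy: "0 \<le> x" "x < y" "y \<le> 1" "{x<..<y} \<inter> (P \<union> Q) = {}"
    then have "{x<..<y} \<inter> P = {}" "{x<..<y} \<inter> Q = {}" by blast+
    with xy show "u x = w x \<longrightarrow> u y = w y"
      using lift_on_unique[OF P(2) Q(2), of x y] by blast
  qed (use P(1) Q(1) in auto)
  with assms(3) show ?thesis by blast
qed

lemma Hol_eq: "has_hol c g \<Longrightarrow> Hol G \<theta> c = g"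
  unfolding Hol_def
proof (rule the_equality)
  assume g: "has_hol c g"
  then show "\<exists>u. horizontal_lift G \<theta> c u \<and> u 0 = \<one> \<and> g = u 1"
    by (auto simp: has_hol_def)
  fix h assume "\<exists>u. horizontal_lift G \<theta> c u \<and> u 0 = \<one> \<and> h = u 1"
  then obtain w where w: "horizontal_lift G \<theta> c w" "w 0 = \<one>" "h = w 1" by blast
  from g obtain u where u: "horizontal_lift G \<theta> c u" "u 0 = \<one>" "u 1 = g"
    and c: "c ` {0..1} \<subseteq> std_simplex I"
    unfolding has_hol_def by blast
  show "h = g"
    using horizontal_lift_unique[OF w(1) u(1) _ c] u w by simp
qed

lemma has_holI_lift_on:
  assumes "lift_on G I \<theta> {0..1} c c' u" "u 0 = \<one>"
  shows "has_hol c (u 1)"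
  unfolding has_hol_def
proof (intro conjI exI)
  show "c ` {0..1} \<subseteq> std_simplex I" using assms(1) by (simp add: lift_on_def)
  show "horizontal_lift G \<theta> c u"
  proof (rule horizontal_liftI[of "{}"])
    fix a b :: real assume "0 \<le> a" "b \<le> 1"
    then show "\<exists>c'. lift_on G I \<theta> {a..b} c c' u"
      using lift_on_subset[OF assms(1), of "{a..b}"] by auto
  qed simp
qed (use assms in auto)

lemma lift_on_linepathI:
  assumes "x \<in> std_simplex I" "y \<in> std_simplex I"
    and "smooth_group_path G {0..1} u"
    and "log_derivative G {0..1} u (\<lambda>t f. - \<theta> (linepath x y t) (y - x) f)"
  shows "lift_on G I \<theta> {0..1} (linepath x y) (\<lambda>_. y - x) u"
proof -
  have "((linepath x y) has_vector_derivative y - x) (at t within {0..1})" for t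
    by (rule has_vector_derivative_linepath_within)
  then show ?thesis
    unfolding lift_on_def using assms
    by (auto simp: linepath_in_simplex diff_in_simplex_tangent
        intro: smooth_curve_onI[of "{0..1}" "\<lambda>_. y - x"])
qed

text \<open>Along a segment the horizontality condition is a logarithmic equation on
  \<open>{0..1}\<close> with smooth right-hand side, so \<open>log_solvable\<close> supplies the
  lift.\<close>

lemma has_hol_linepath_exists:
  assumes "x \<in> std_simplex I" "y \<in> std_simplex I"
  shows "\<exists>g. has_hol (linepath x y) g"
proof -
  have "smooth_curve_on {0..1} (linepath x y)"
    by (rule smooth_curve_onI[of "{0..1}" "\<lambda>_. y - x"]) (auto intro: has_vector_derivative_linepath_within)
  then have "smooth_alg_path G {0..1} (\<lambda>t f. - \<theta> (linepath x y t) (y - x) f)"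
    by (rule smooth_alg_path_form) (use assms in \<open>auto simp: linepath_in_simplex diff_in_simplex_tangent\<close>)
  then obtain u where "solves_log G (\<lambda>t f. - \<theta> (linepath x y t) (y - x) f) u"
    using solvable unfolding log_solvable_def by blast
  then show ?thesis
    using has_holI_lift_on[OF lift_on_linepathI[OF assms]] unfolding solves_log_def by blast
qed

text \<open>The constant path is the degenerate segment \<open>linepath x x\<close>; the form
  vanishes on its zero velocity, so the constant path at the unit is horizontal.\<close>

lemma has_hol_const:
  assumes "x \<in> std_simplex I"
  shows "has_hol (\<lambda>_. x) \<one>"
proof -
  have "x - x \<in> simplex_tangent I" by (rule diff_in_simplex_tangent[OF assms assms])
  then have "\<theta> x 0 f = 0" for f
    using form_scale[OF assms, of 0 0 f] by simp
  then have "lift_on G I \<theta> {0..1} (linepath x x) (\<lambda>_. x - x) (\<lambda>_. \<one>)"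
    by (intro lift_on_linepathI assms) (auto simp: smooth_group_path_def log_derivative_def linepath_def)
  from has_holI_lift_on[OF this refl] show ?thesis
    by (simp add: linepath_refl)
qed

text \<open>The lift of \<open>d\<close> is right-translated by \<open>g\<close> so that it starts
  where the lift of \<open>c\<close> ends. This is why the factors appear in reverse order.\<close>

lemma has_hol_join:
  assumes c: "has_hol c g" and d: "has_hol d h" and cd: "pathfinish c = pathstart d"
  shows "has_hol (c +++ d) (h \<otimes> g)"
proof -
  from c obtain u where u: "horizontal_lift G \<theta> c u" "u 0 = \<one>" "u 1 = g"
    and c': "c ` {0..1} \<subseteq> std_simplex I" unfolding has_hol_def by blast
  from d obtain w where w: "horizontal_lift G \<theta> d w" "w 0 = \<one>" "w 1 = h"
    and d': "d ` {0..1} \<subseteq> std_simplex I" unfolding has_hol_def by blast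
  from horizontal_liftE[OF u(1) c'] obtain P where P: "finite P"
    "\<And>a b. 0 \<le> a \<Longrightarrow> a < b \<Longrightarrow> b \<le> 1 \<Longrightarrow> {a<..<b} \<inter> P = {} \<Longrightarrow>
       lift_on G I \<theta> {a..b} c (\<lambda>t. vector_derivative c (at t within {a..b})) u" by blast
  from horizontal_liftE[OF w(1) d'] obtain Q where Q: "finite Q"
    "\<And>a b. 0 \<le> a \<Longrightarrow> a < b \<Longrightarrow> b \<le> 1 \<Longrightarrow> {a<..<b} \<inter> Q = {} \<Longrightarrow>
       lift_on G I \<theta> {a..b} d (\<lambda>t. vector_derivative d (at t within {a..b})) w" by blast
  have g: "g \<in> carrier G" by (rule has_hol_in_carrier[OF c])
  have h: "h \<in> carrier G" by (rule has_hol_in_carrier[OF d])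
  define z where "z = (\<lambda>t. if t \<le> 1/2 then u (2 * t) else w (2 * t - 1) \<otimes> g)"
  \<comment> \<open>Break points of both paths, rescaled to their halves. Including
    \<open>1/2\<close> forces every admissible interval into one half.\<close>
  let ?R = "insert (1/2) ((\<lambda>p. p / 2) ` P \<union> (\<lambda>p. (p + 1) / 2) ` Q)"
  have "horizontal_lift G \<theta> (c +++ d) z"
  proof (rule horizontal_liftI)
    show "finite ?R" using P(1) Q(1) by simp
    fix a b :: real
    assume ab: "0 \<le> a" "a < b" "b \<le> 1" "{a<..<b} \<inter> ?R = {}"
    then consider "b \<le> 1/2" | "1/2 \<le> a" by fastforce
    then show "\<exists>e. lift_on G I \<theta> {a..b} (c +++ d) e z"
    proof cases
      case 1
      have avoid: "{2 * a<..<2 * b} \<inter> P = {}"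
      proof -
        have "p / 2 \<notin> {a<..<b}" if "p \<in> P" for p using that ab(4) by blast
        then show ?thesis by fastforce
      qed
      have "lift_on G I \<theta> {2 * a..2 * b} c (\<lambda>t. vector_derivative c (at t within {2 * a..2 * b})) u"
        by (rule P(2)) (use 1 ab avoid in auto)
      then have "lift_on G I \<theta> {a..b} (\<lambda>t. c (2 * t + 0))
          (\<lambda>t. 2 *\<^sub>R vector_derivative c (at (2 * t + 0) within {2 * a..2 * b})) (\<lambda>t. u (2 * t + 0))"
        by (rule lift_on_affine) auto
      then show ?thesis
        by (intro exI, elim lift_on_cong) (use 1 in \<open>auto simp: joinpaths_def z_def\<close>)
    next
      case 2
      have avoid: "{2 * a - 1<..<2 * b - 1} \<inter> Q = {}"
      proof -
        have "(p + 1) / 2 \<notin> {a<..<b}" if "p \<in> Q" for p using that ab(4) by blast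
        then show ?thesis by (fastforce simp: field_simps)
      qed
      have "lift_on G I \<theta> {2 * a - 1..2 * b - 1} d
          (\<lambda>t. vector_derivative d (at t within {2 * a - 1..2 * b - 1})) w"
        by (rule Q(2)) (use 2 ab avoid in auto)
      then have "lift_on G I \<theta> {a..b} (\<lambda>t. d (2 * t + (-1)))
          (\<lambda>t. 2 *\<^sub>R vector_derivative d (at (2 * t + (-1)) within {2 * a - 1..2 * b - 1}))
          (\<lambda>t. w (2 * t + (-1)))"
        by (rule lift_on_affine) auto
      note l = lift_on_right_translate[OF this g]
      \<comment> \<open>At \<open>t = 1/2\<close> the concatenation and \<open>z\<close> follow
        their first branch; the second gives the same values there, as the end points match and
        \<open>w\<close> starts at the unit.\<close>
      have "(c +++ d) t = d (2 * t + (-1)) \<and> z t = w (2 * t + (-1)) \<otimes> g" if "t \<in> {a..b}" for t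
      proof (cases "t = 1/2")
        case True
        show "(c +++ d) t = d (2 * t + (-1)) \<and> z t = w (2 * t + (-1)) \<otimes> g"
          unfolding True using cd u(3) w(2) g
          by (auto simp: joinpaths_def z_def pathfinish_def pathstart_def)
      next
        case False
        then have "\<not> t \<le> 1/2" using that 2 by auto
        then show "(c +++ d) t = d (2 * t + (-1)) \<and> z t = w (2 * t + (-1)) \<otimes> g"
          by (simp_all add: joinpaths_def z_def)
      qed
      with l show ?thesis
        by (intro exI, elim lift_on_cong) auto
    qed
  qed
  moreover have "z 0 = \<one>" "z 1 = h \<otimes> g" using u w by (auto simp: z_def)
  moreover have "(c +++ d) ` {0..1} \<subseteq> std_simplex I"
    using path_image_join_subset[of c d] c' d' unfolding path_image_def by blast
  ultimately show ?thesis unfolding has_hol_def by blast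
qed

text \<open>The lift is run backwards from its end value \<open>g\<close>; right translation by
  \<open>inv g\<close> makes it start at the unit.\<close>

lemma has_hol_reversepath:
  assumes c: "has_hol c g"
  shows "has_hol (reversepath c) (inv g)"
proof -
  from c obtain u where u: "horizontal_lift G \<theta> c u" "u 0 = \<one>" "u 1 = g"
    and c': "c ` {0..1} \<subseteq> std_simplex I" unfolding has_hol_def by blast
  from horizontal_liftE[OF u(1) c'] obtain P where P: "finite P"
    "\<And>a b. 0 \<le> a \<Longrightarrow> a < b \<Longrightarrow> b \<le> 1 \<Longrightarrow> {a<..<b} \<inter> P = {} \<Longrightarrow>
       lift_on G I \<theta> {a..b} c (\<lambda>t. vector_derivative c (at t within {a..b})) u" by blast
  have g: "g \<in> carrier G" by (rule has_hol_in_carrier[OF c])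
  have "horizontal_lift G \<theta> (reversepath c) (\<lambda>t. u (1 - t) \<otimes> inv g)"
  proof (rule horizontal_liftI)
    show "finite ((\<lambda>p. 1 - p) ` P)" using P(1) by simp
    fix a b :: real
    assume ab: "0 \<le> a" "a < b" "b \<le> 1" "{a<..<b} \<inter> (\<lambda>p. 1 - p) ` P = {}"
    have avoid: "{1 - b<..<1 - a} \<inter> P = {}"
    proof -
      have "1 - p \<notin> {a<..<b}" if "p \<in> P" for p using that ab(4) by blast
      then show ?thesis by fastforce
    qed
    have "lift_on G I \<theta> {1 - b..1 - a} c (\<lambda>t. vector_derivative c (at t within {1 - b..1 - a})) u"
      by (rule P(2)) (use ab avoid in auto)
    then have "lift_on G I \<theta> {a..b} (\<lambda>t. c (-1 * t + 1))
        (\<lambda>t. -1 *\<^sub>R vector_derivative c (at (-1 * t + 1) within {1 - b..1 - a})) (\<lambda>t. u (-1 * t + 1))"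
      by (rule lift_on_affine) auto
    from lift_on_right_translate[OF this inv_closed[OF g]]
    show "\<exists>e. lift_on G I \<theta> {a..b} (reversepath c) e (\<lambda>t. u (1 - t) \<otimes> inv g)"
      by (intro exI, elim lift_on_cong) (auto simp: reversepath_def)
  qed
  moreover have "reversepath c ` {0..1} \<subseteq> std_simplex I"
    using path_image_reversepath[of c] c' unfolding path_image_def by simp
  moreover have "u (1 - 0) \<otimes> inv g = \<one>" "u (1 - 1) \<otimes> inv g = inv g" using u g by auto
  ultimately show ?thesis unfolding has_hol_def by blast
qed

text \<open>The end points are carried through the induction because \<open>has_hol_join\<close>
  requires the pieces to meet.\<close>

lemma has_hol_broken_line:
  assumes "\<And>k. k \<le> n \<Longrightarrow> p k \<in> std_simplex I"
  shows "pathstart (broken_line p n) = p 0 \<and> pathfinish (broken_line p n) = p n \<and>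
    (\<exists>g. has_hol (broken_line p n) g)"
  using assms
proof (induction p n rule: broken_line.induct)
  case (1 p)
  then show ?case using has_hol_const by (auto simp: pathstart_def pathfinish_def)
next
  case (2 p)
  then show ?case using has_hol_linepath_exists by simp
next
  case (3 p k)
  obtain h where "has_hol (linepath (p (Suc k)) (p (Suc (Suc k)))) h"
    using has_hol_linepath_exists 3(2) by (metis le_SucI order_refl)
  moreover have "pathstart (broken_line p (Suc k)) = p 0 \<and>
      pathfinish (broken_line p (Suc k)) = p (Suc k) \<and> (\<exists>g. has_hol (broken_line p (Suc k)) g)"
    by (rule 3(1)) (simp add: 3(2))
  ultimately show ?case using has_hol_join by (simp del: broken_line.simps(2)) fastforce
qed

end

section \<open>The holonomy matrix\<close>

context connection
begin

text \<open>The hypothesis puts every vertex visited on the way from 0 to \<open>i\<close> into the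
  simplex, whichever sign \<open>i\<close> has.\<close>

lemma has_hol_vertex_path:
  assumes "{min 0 i..max 0 i} \<subseteq> I"
  shows "pathstart (vertex_path i) = vertex 0 \<and> pathfinish (vertex_path i) = vertex i \<and>
    (\<exists>g. has_hol (vertex_path i) g)"
proof (cases "0 \<le> i")
  case True
  have "vertex (int k) \<in> std_simplex I" if "k \<le> nat i" for k
    by (rule vertex_in_simplex) (use assms True that in auto)
  from has_hol_broken_line[OF this, of "nat i"] True show ?thesis
    by (simp add: vertex_path_def)
next
  case False
  have "vertex (- int k) \<in> std_simplex I" if "k \<le> nat (- i)" for k
    by (rule vertex_in_simplex) (use assms False that in auto)
  from has_hol_broken_line[OF this, of "nat (- i)"] False show ?thesis
    by (simp add: vertex_path_def)
qed

text \<open>With \<open>x\<close> and \<open>y\<close> the holonomies of the paths to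
  \<open>i\<close> and \<open>j\<close>, the loop has holonomy
  \<open>inv y \<otimes> (g \<otimes> x)\<close>, and the outer factors of the matrix entry cancel
  \<open>inv y\<close> and \<open>x\<close>.\<close>

lemma holonomy_matrix_eq:
  assumes I: "\<And>i. i \<in> I \<Longrightarrow> {min 0 i..max 0 i} \<subseteq> I" and ij: "i \<in> I" "j \<in> I"
    and g: "has_hol (linepath (vertex i) (vertex j)) g"
  shows "holonomy_matrix G I \<theta> (i, j) = g"
proof -
  obtain x where x: "has_hol (vertex_path i) x"
    and i: "pathstart (vertex_path i) = vertex 0" "pathfinish (vertex_path i) = vertex i"
    using has_hol_vertex_path[OF I[OF ij(1)]] by blast
  obtain y where y: "has_hol (vertex_path j) y"
    and j: "pathstart (vertex_path j) = vertex 0" "pathfinish (vertex_path j) = vertex j"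
    using has_hol_vertex_path[OF I[OF ij(2)]] by blast
  have "has_hol (vertex_path i +++ linepath (vertex i) (vertex j)) (g \<otimes> x)"
    by (rule has_hol_join[OF x g]) (simp add: i)
  then have "has_hol ((vertex_path i +++ linepath (vertex i) (vertex j)) +++ reversepath (vertex_path j))
      (inv y \<otimes> (g \<otimes> x))"
    by (rule has_hol_join[OF _ has_hol_reversepath[OF y]]) (simp add: j)
  then have "holonomy_matrix G I \<theta> (i, j) = y \<otimes> (inv y \<otimes> (g \<otimes> x)) \<otimes> inv x"
    using x y ij by (simp add: holonomy_matrix_def Hol_eq)
  also have "\<dots> = g"
    using has_hol_in_carrier[OF x] has_hol_in_carrier[OF y] has_hol_in_carrier[OF g]
    by (simp add: m_assoc[symmetric]) (simp add: m_assoc)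
  finally show ?thesis .
qed

text \<open>Reversing an edge inverts its holonomy, and an edge from a vertex to itself is a
  constant path.\<close>

lemma holonomy_matrix_in_PC:
  assumes I: "\<And>i. i \<in> I \<Longrightarrow> {min 0 i..max 0 i} \<subseteq> I"
  shows "holonomy_matrix G I \<theta> \<in> PC G I"
proof -
  let ?A = "holonomy_matrix G I \<theta>"
  have ex: "\<exists>g. has_hol (linepath (vertex i) (vertex j)) g" if "i \<in> I" "j \<in> I" for i j
    by (intro has_hol_linepath_exists vertex_in_simplex that)
  have hol: "has_hol (linepath (vertex i) (vertex j)) (?A (i, j))" if "i \<in> I" "j \<in> I" for i j
    using ex[OF that] holonomy_matrix_eq[OF I that] by auto
  have "?A (j, i) = inv (?A (i, j))" if "i \<in> I" "j \<in> I" for i j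
    using has_hol_reversepath[OF hol[OF that]] holonomy_matrix_eq[OF I that(2,1)] by simp
  moreover have "?A (i, i) = \<one>" if "i \<in> I" for i
    using has_hol_const[OF vertex_in_simplex[OF that]] holonomy_matrix_eq[OF I that that]
    by (simp add: linepath_refl)
  moreover have "?A \<in> (I \<times> I) \<rightarrow>\<^sub>E carrier G"
    using has_hol_in_carrier[OF hol] by (auto simp: holonomy_matrix_def PiE_iff)
  ultimately show ?thesis unfolding PC_def by blast
qed

end

section \<open>Connections with prescribed holonomy matrix\<close>

text \<open>Uniqueness in \<open>log_solvable\<close> turns the definite description in
  \<open>lie_exp\<close> into the end value of an actual solution curve.\<close>

lemma lie_exp_solution:
  assumes "log_solvable G" "X \<in> lie_alg G"
  obtains u where "solves_log G (\<lambda>_. X) u" "u 1 = lie_exp G X"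
proof -
  have "smooth_alg_path G {0..1} (\<lambda>_. X)"
    using assms(2) by (auto simp: smooth_alg_path_def)
  with assms(1) obtain u where u: "solves_log G (\<lambda>_. X) u"
    "\<forall>w. solves_log G (\<lambda>_. X) w \<longrightarrow> (\<forall>t\<in>{0..1}. w t = u t)"
    unfolding log_solvable_def by blast
  have "lie_exp G X = u 1"
    unfolding lie_exp_def
  proof (rule the_equality)
    fix g assume "\<exists>w. solves_log G (\<lambda>_. X) w \<and> g = w 1"
    then obtain w where w: "solves_log G (\<lambda>_. X) w" "g = w 1" by blast
    then show "g = u 1" using u(2)[rule_format, OF w(1), of 1] by simp
  qed (use u(1) in blast)
  with u(1) that show thesis by simp
qed

lemma lie_alg_sum:
  assumes G: "frolicher_lie_group G" and "finite J" "\<And>k. k \<in> J \<Longrightarrow> Z k \<in> lie_alg G"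
  shows "(\<lambda>f. \<Sum>k\<in>J. w k * Z k f) \<in> lie_alg G"
  using assms(2,3)
proof (induction J)
  case empty
  have F: "frolicher_group G" using G by (simp add: frolicher_lie_group_def)
  then interpret group G by (simp add: frolicher_group_def)
  \<comment> \<open>The empty sum is the zero vector, obtained as 0 times the velocity of a constant
    curve.\<close>
  have "velocity G (\<lambda>_. \<one>\<^bsub>G\<^esub>) \<in> lie_alg G"
    unfolding lie_alg_def using const_in_curves[OF F, of "\<one>\<^bsub>G\<^esub>"] by blast
  from lie_alg_scale[OF G this, of 0] show ?case by simp
next
  case (insert k J)
  then have "(\<lambda>f. w k * Z k f + 1 * (\<Sum>k\<in>J. w k * Z k f)) \<in> lie_alg G"
    by (intro lie_alg_lincomb[OF G]) auto
  with insert show ?case by simp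
qed

section \<open>The cut-off function and the reparametrization of edges\<close>

text \<open>The threshold \<open>1/4\<close> is positive, so only finitely many coordinates pass it,
  and below \<open>1/2\<close>, so that both coordinates pass it in the middle of an edge.\<close>

definition bump :: "real \<Rightarrow> real" where
  "bump x = flat 0 (x - 1/4)"

lemma bump_eq_0: "x \<le> 1/4 \<Longrightarrow> bump x = 0"
  and bump_pos: "1/4 < x \<Longrightarrow> 0 < bump x"
  and bump_nonneg: "0 \<le> bump x"
  by (auto simp: bump_def flat_def)

lemma smooth_bump: "smooth_curve_on UNIV bump"
  unfolding bump_def using smooth_curve_on_affine[OF smooth_flat, of UNIV 1 "- 1/4" 0] by simp

lemma smooth_curve_on_bump: "smooth_curve_on S g \<Longrightarrow> smooth_curve_on S (\<lambda>t. bump (g t))"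
  by (rule smooth_curve_on_compose[OF smooth_bump]) auto

text \<open>\<open>p\<close> is an antiderivative of \<open>bump (1 - t) * bump t\<close>,
  normalised to run from 0 to 1; \<open>r\<close> is the reciprocal of the integral of this product
  over \<open>{0..1}\<close>.\<close>

lemma bump_reparametrization:
  obtains p r where "smooth_curve_on {0..1} p" "p 0 = 0" "p 1 = 1" "p ` {0..1} \<subseteq> {0..1}"
    "\<And>t. t \<in> {0..1} \<Longrightarrow> (p has_real_derivative r * (bump (1 - t) * bump t)) (at t within {0..1})"
proof -
  let ?f = "\<lambda>t. bump (1 - t) * bump t"
  have "smooth_curve_on UNIV (\<lambda>t. bump (1 - t))"
    using smooth_curve_on_affine[OF smooth_bump, of UNIV "-1" 1] by simp
  then have f: "smooth_curve_on UNIV ?f"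
    by (rule smooth_curve_on_mult[OF _ smooth_bump])
  \<comment> \<open>A larger interval makes the derivative of the antiderivative two-sided on all of
    \<open>{0..1}\<close>, as the monotonicity rules demand.\<close>
  have "continuous_on {-1..2} ?f"
    using smooth_curve_on_imp_continuous_on[OF f] by (rule continuous_on_subset) simp
  then obtain g where g: "\<And>t. t \<in> {-1..2} \<Longrightarrow> (g has_vector_derivative ?f t) (at t within {-1..2})"
    using antiderivative_continuous by blast
  have g': "(g has_real_derivative ?f t) (at t)" if "0 \<le> t" "t \<le> 1" for t
    using g[of t] at_within_Icc_at[of "-1" t 2] that
    by (simp add: has_real_derivative_iff_has_vector_derivative)
  have mono: "g s \<le> g t" if "0 \<le> s" "s \<le> t" "t \<le> 1" for s t
  proof (rule DERIV_nonneg_imp_nondecreasing[OF that(2)])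
    fix x assume "s \<le> x" "x \<le> t"
    then show "\<exists>y. (g has_real_derivative y) (at x) \<and> 0 \<le> y"
      using that g'[of x] bump_nonneg by (intro exI[of _ "?f x"]) auto
  qed
  \<comment> \<open>Between \<open>1/3\<close> and \<open>2/3\<close> both \<open>t\<close> and
    \<open>1 - t\<close> exceed \<open>1/4\<close>, so the derivative is strictly positive; this
    makes the normalising constant well-defined.\<close>
  have "g (1/3) < g (2/3)"
  proof (rule DERIV_pos_imp_increasing[of "1/3" "2/3" g])
    fix x :: real assume "1/3 \<le> x" "x \<le> 2/3"
    then show "\<exists>y. (g has_real_derivative y) (at x) \<and> 0 < y"
      using g'[of x] bump_pos[of x] bump_pos[of "1 - x"] by (intro exI[of _ "?f x"]) auto
  qed simp
  with mono[of 0 "1/3"] mono[of "2/3" 1] have pos: "g 0 < g 1" by simp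
  let ?p = "\<lambda>t. (g t - g 0) / (g 1 - g 0)"
  let ?r = "1 / (g 1 - g 0)"
  have p: "(?p has_real_derivative ?r * ?f t) (at t within {0..1})" if "t \<in> {0..1}" for t
  proof -
    have "(g has_real_derivative ?f t) (at t within {0..1})"
      using g'[of t] that by (auto intro: has_field_derivative_at_within)
    then show ?thesis
      using pos by (auto intro!: derivative_eq_intros)
  qed
  show thesis
  proof (rule that[of ?p ?r])
    have "smooth_curve_on {0..1} (\<lambda>t. ?r * ?f t)"
      by (intro smooth_curve_on_mult[OF smooth_curve_on_const] smooth_curve_on_subset[OF f]) simp
    then show "smooth_curve_on {0..1} ?p"
      by (rule smooth_curve_onI) (use p in \<open>simp add: has_real_derivative_iff_has_vector_derivative\<close>)
    show "?p ` {0..1} \<subseteq> {0..1}"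
      using mono[of 0] mono[of _ 1] pos by auto
  qed (use pos p in auto)
qed

section \<open>The connection form built from edges\<close>

text \<open>The factors \<open>bump\<close> make the form vanish near the vertices, where infinitely many edges
  meet.\<close>

definition large_pairs :: "int set \<Rightarrow> int l1 \<Rightarrow> (int \<times> int) set" where
  "large_pairs I x = {(i, j). i \<in> I \<and> j \<in> I \<and> i < j \<and> 1/4 < coord x i \<and> 1/4 < coord x j}"

text \<open>Summing over the large pairs at \<open>x\<close> only makes the sum finite at every
  point. The minus sign cancels the one in the equation of horizontal lifts.\<close>

definition edge_form ::
  "int set \<Rightarrow> real \<Rightarrow> (int \<times> int \<Rightarrow> 'g tvec) \<Rightarrow> int l1 \<Rightarrow> int l1 \<Rightarrow> 'g tvec" where
  "edge_form I r X x v = (\<lambda>f. \<Sum>k\<in>large_pairs I x.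
     - r * (bump (coord x (fst k)) * bump (coord x (snd k))) * coord v (snd k) * X k f)"

text \<open>Any further pair contains a coordinate of at most \<open>1/4\<close>, where
  \<open>bump\<close> vanishes. Along a path one fixed finite \<open>F\<close> can therefore replace
  the moving index set.\<close>

lemma edge_form_superset:
  assumes "finite F" "large_pairs I x \<subseteq> F" "F \<subseteq> {(i, j). i \<in> I \<and> j \<in> I \<and> i < j}"
  shows "edge_form I r X x v f = (\<Sum>k\<in>F.
     - r * (bump (coord x (fst k)) * bump (coord x (snd k))) * coord v (snd k) * X k f)"
  unfolding edge_form_def
proof (rule sum.mono_neutral_left[OF assms(1,2)], rule ballI)
  fix k assume "k \<in> F - large_pairs I x"
  then have "coord x (fst k) \<le> 1/4 \<or> coord x (snd k) \<le> 1/4"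
    using assms(3) by (force simp: large_pairs_def)
  then show "- r * (bump (coord x (fst k)) * bump (coord x (snd k))) * coord v (snd k) * X k f = 0"
    by (auto simp: bump_eq_0)
qed

lemma finite_large_pairs_path:
  fixes c :: "real \<Rightarrow> int l1"
  assumes "continuous_on {0..1} c"
  shows "finite (\<Union>t\<in>{0..1}. large_pairs I (c t))"
proof (rule finite_subset)
  let ?L = "{i. \<exists>t\<in>{0..1}. 1/4 < \<bar>coord (c t) i\<bar>}"
  show "finite (?L \<times> ?L)" using finite_large_coords_path[OF assms, of "1/4"] by simp
  show "(\<Union>t\<in>{0..1}. large_pairs I (c t)) \<subseteq> ?L \<times> ?L"
    by (auto simp: large_pairs_def intro!: bexI less_le_trans[OF _ abs_ge_self])
qed

lemma edge_form_in_one_forms: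
  assumes G: "frolicher_lie_group G"
    and X: "\<And>i j. i \<in> I \<Longrightarrow> j \<in> I \<Longrightarrow> X (i, j) \<in> lie_alg G"
  shows "edge_form I r X \<in> one_forms G I"
proof -
  have mem: "edge_form I r X x v \<in> lie_alg G" for x v
  proof -
    \<comment> \<open>A single point is treated as a constant path.\<close>
    have "finite (large_pairs I x)"
      using finite_large_pairs_path[of "\<lambda>_. x" I] by simp
    then show ?thesis
      unfolding edge_form_def by (rule lie_alg_sum[OF G]) (auto simp: large_pairs_def X)
  qed
  have lin: "edge_form I r X x (a *\<^sub>R v + b *\<^sub>R w) =
      (\<lambda>f. a * edge_form I r X x v f + b * edge_form I r X x w f)" for x a v b w
    unfolding edge_form_def sum_distrib_left sum.distrib[symmetric]
    by (intro ext sum.cong refl) (simp add: coord_add_aux coord_scaleR_aux algebra_simps)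
  have "smooth_curve_on {0..1} (\<lambda>t. edge_form I r X (c t) (w t) f)"
    if c: "smooth_curve_on {0..1} c" and w: "smooth_curve_on {0..1} w" for c w f
  proof -
    \<comment> \<open>All pairs that are ever large along \<open>c\<close>: compactness makes this
      set finite, so the form along \<open>c\<close> is a fixed finite sum of products of smooth
      functions.\<close>
    let ?F = "\<Union>t\<in>{0..1}. large_pairs I (c t)"
    have "smooth_curve_on {0..1} (\<lambda>t. \<Sum>k\<in>?F.
        - r * (bump (coord (c t) (fst k)) * bump (coord (c t) (snd k))) * coord (w t) (snd k) * X k f)"
      by (intro smooth_curve_on_sum smooth_curve_on_mult smooth_curve_on_const smooth_curve_on_bump
          smooth_curve_on_bounded_linear[OF bounded_linear_coord] c w)
    then show ?thesis
    proof (rule smooth_curve_on_cong)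
      fix t :: real assume t: "t \<in> {0..1}"
      show "edge_form I r X (c t) (w t) f = (\<Sum>k\<in>?F.
          - r * (bump (coord (c t) (fst k)) * bump (coord (c t) (snd k))) * coord (w t) (snd k) * X k f)"
      proof (rule edge_form_superset)
        show "finite ?F"
          by (rule finite_large_pairs_path[OF smooth_curve_on_imp_continuous_on[OF c]])
      qed (use t in \<open>auto simp: large_pairs_def\<close>)
    qed
  qed
  with mem have smooth: "smooth_alg_path G {0..1} (\<lambda>t. edge_form I r X (c t) (w t))"
    if "smooth_curve_on {0..1} c" "smooth_curve_on {0..1} w" for c w
    using that unfolding smooth_alg_path_def by blast
  show ?thesis
    unfolding one_forms_def
    by (intro CollectI conjI ballI allI impI mem lin smooth; elim conjE)
qed

text \<open>All coordinates but those at \<open>i\<close> and \<open>j\<close> vanish on this edge,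
  so \<open>(i, j)\<close> is the only pair that can be large, and the coordinate \<open>j\<close>
  of the direction vector is 1.\<close>

lemma edge_form_on_edge:
  assumes "i \<in> I" "j \<in> I" "i < j"
  shows "edge_form I r X (linepath (vertex i) (vertex j) t) (vertex j - vertex i) f =
    - (r * (bump (1 - t) * bump t) * X (i, j) f)"
proof -
  have c: "coord (linepath (vertex i) (vertex j) t) k =
      (if k = i then 1 - t else 0) + (if k = j then t else 0)" for k
    by (simp add: linepath_def coord_add_aux coord_scaleR_aux coord_vertex)
  have "large_pairs I (linepath (vertex i) (vertex j) t) \<subseteq> {(i, j)}"
    using assms(3) by (auto simp: large_pairs_def c split: if_splits)
  then have "edge_form I r X (linepath (vertex i) (vertex j) t) (vertex j - vertex i) f =
    (\<Sum>k\<in>{(i, j)}. - r * (bump (coord (linepath (vertex i) (vertex j) t) (fst k)) *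
       bump (coord (linepath (vertex i) (vertex j) t) (snd k))) * coord (vertex j - vertex i) (snd k) * X k f)"
    using assms by (intro edge_form_superset) auto
  then show ?thesis
    using assms(3) by (simp add: c coord_diff coord_vertex)
qed

section \<open>Surjectivity of the holonomy matrix\<close>

lemma holonomy_matrix_surj:
  assumes I: "\<And>i. i \<in> I \<Longrightarrow> {min 0 i..max 0 i} \<subseteq> I"
    and lie: "frolicher_lie_group G" and solvable: "log_solvable G" and exp: "exponential G"
    and a: "a \<in> PC G I"
  shows "\<exists>\<theta>\<in>one_forms G I. holonomy_matrix G I \<theta> = a"
proof -
  note a' = a[unfolded PC_def mem_Collect_eq]
  have car: "a k \<in> carrier G" if "k \<in> I \<times> I" for k
    using conjunct1[OF a'] that by (rule PiE_mem)
  have anti: "a (j, i) = inv\<^bsub>G\<^esub> (a (i, j))" if "i \<in> I" "j \<in> I" for i j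
    using bspec[OF bspec[OF conjunct1[OF conjunct2[OF a']] that(1)] that(2)] .
  have diag: "a (i, i) = \<one>\<^bsub>G\<^esub>" if "i \<in> I" for i
    using bspec[OF conjunct2[OF conjunct2[OF a']] that] .
  have "\<exists>X u. X \<in> lie_alg G \<and> solves_log G (\<lambda>_. X) u \<and> u 1 = a k" if k: "k \<in> I \<times> I" for k
  proof -
    have "a k \<in> lie_exp G ` lie_alg G"
      using exp car[OF k] by (simp add: exponential_def)
    then obtain X where X: "X \<in> lie_alg G" "a k = lie_exp G X" by blast
    from lie_exp_solution[OF solvable X(1)] X show ?thesis by metis
  qed
  then obtain X u where X: "\<And>k. k \<in> I \<times> I \<Longrightarrow> X k \<in> lie_alg G"
    and u: "\<And>k. k \<in> I \<times> I \<Longrightarrow> solves_log G (\<lambda>_. X k) (u k)"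
    and u1: "\<And>k. k \<in> I \<times> I \<Longrightarrow> u k 1 = a k"
    by metis
  obtain p r where p: "smooth_curve_on {0..1} p" "p 0 = 0" "p 1 = 1" "p ` {0..1} \<subseteq> {0..1}"
    "\<And>t. t \<in> {0..1} \<Longrightarrow> (p has_real_derivative r * (bump (1 - t) * bump t)) (at t within {0..1})"
    by (rule bump_reparametrization) blast
  let ?\<theta> = "edge_form I r X"
  have form: "?\<theta> \<in> one_forms G I"
    by (rule edge_form_in_one_forms[OF lie]) (simp add: X)
  interpret connection G I ?\<theta>
    by unfold_locales (fact lie solvable form)+
  have edge: "has_hol (linepath (vertex i) (vertex j)) (a (i, j))" if ij: "i \<in> I" "j \<in> I" "i < j" for i j
  proof -
    \<comment> \<open>The exponential curve of \<open>X (i, j)\<close> traversed along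
      \<open>p\<close>: its logarithmic derivative is \<open>X (i, j)\<close> times the derivative
      of \<open>p\<close>, which is minus the form on this edge. It ends at
      \<open>u (i, j) 1 = a (i, j)\<close> since \<open>p 1 = 1\<close>.\<close>
    let ?u = "\<lambda>t. u (i, j) (p t)"
    have s: "solves_log G (\<lambda>_. X (i, j)) (u (i, j))" using u ij by simp
    have "log_derivative G {0..1} ?u (\<lambda>t f. r * (bump (1 - t) * bump t) * X (i, j) f)"
      by (rule log_derivative_reparam[OF _ p(4,5)]) (use s in \<open>simp add: solves_log_def\<close>)
    then have "log_derivative G {0..1} ?u
        (\<lambda>t f. - ?\<theta> (linepath (vertex i) (vertex j) t) (vertex j - vertex i) f)"
      by (simp add: edge_form_on_edge ij)
    moreover have "smooth_group_path G {0..1} ?u"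
      by (rule smooth_group_path_reparam[OF _ p(1,4)]) (use s in \<open>simp add: solves_log_def\<close>)
    ultimately have "lift_on G I ?\<theta> {0..1} (linepath (vertex i) (vertex j)) (\<lambda>_. vertex j - vertex i) ?u"
      by (intro lift_on_linepathI vertex_in_simplex ij)
    from has_holI_lift_on[OF this] show ?thesis
      using s p(2,3) u1 ij by (simp add: solves_log_def)
  qed
  \<comment> \<open>The form was built from pairs with \<open>i < j\<close> alone; the relations of
    \<open>PC\<close> match the reversed and the degenerate edges.\<close>
  have "has_hol (linepath (vertex i) (vertex j)) (a (i, j))" if ij: "i \<in> I" "j \<in> I" for i j
  proof (cases i j rule: linorder_cases)
    case greater
    then show ?thesis
      using has_hol_reversepath[OF edge[OF ij(2,1)]] anti[OF ij(2,1)] by simp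
  next
    case equal
    then show ?thesis
      using has_hol_const[OF vertex_in_simplex[OF ij(1)]] diag[OF ij(1)] by (simp add: linepath_refl)
  qed (use edge ij in blast)
  then have "holonomy_matrix G I ?\<theta> (i, j) = a (i, j)" if "i \<in> I" "j \<in> I" for i j
    using holonomy_matrix_eq[OF I that] that by blast
  \<comment> \<open>Both families are \<open>undefined\<close> off \<open>I \<times> I\<close>, so
    agreement of the entries gives equality of functions.\<close>
  moreover have "holonomy_matrix G I ?\<theta> \<in> extensional (I \<times> I)"
    by (simp add: holonomy_matrix_def)
  moreover have "a \<in> extensional (I \<times> I)"
    using conjunct1[OF a'] by (simp add: PiE_def)
  ultimately have "holonomy_matrix G I ?\<theta> = a"
    by (intro extensionalityI[of _ "I \<times> I"]) auto
  with form show ?thesis by blast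
qed

theorem proposition6p3:
  fixes G :: "('g, 'm) frolicher_monoid_scheme" and I :: "int set"
  assumes "(\<exists>n::nat. 1 \<le> n \<and> I = {0..int n}) \<or> I = {0..} \<or> I = UNIV"
    and "frolicher_lie_group G"
    and "log_solvable G"
    and "exponential G"
  shows "holonomy_matrix G I ` one_forms G I = PC G I"
proof -
  \<comment> \<open>The property shared by all three kinds of index set: they contain every integer
    between 0 and any of their members.\<close>
  have I: "{min 0 i..max 0 i} \<subseteq> I" if "i \<in> I" for i
    using assms(1) that by auto
  show ?thesis
  proof
    show "holonomy_matrix G I ` one_forms G I \<subseteq> PC G I"
    proof clarify
      fix \<theta> assume "\<theta> \<in> one_forms G I"
      then interpret connection G I \<theta>
        by (rule connection.intro[OF assms(2,3)])
      show "holonomy_matrix G I \<theta> \<in> PC G I" by (rule holonomy_matrix_in_PC[OF I])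
    qed
    show "PC G I \<subseteq> holonomy_matrix G I ` one_forms G I"
    proof
      fix a assume "a \<in> PC G I"
      from holonomy_matrix_surj[OF I assms(2-4) this]
      show "a \<in> holonomy_matrix G I ` one_forms G I" by blast
    qed
  qed
qed

end
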